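(* For $n\geq 5$ it holds that $$Aut(UVB_n)\cong N_{Aut(UVP_n)}(UVB_n),$$ where the right-hand side is the normaliser of $UVB_n$ in $Aut(UVP_n)$, with $UVB_n$ regarded as a subgroup of $Aut(UVP_n)$ through its conjugation action on $UVP_n$.
   Context: The unrestricted virtual braid group $UVB_n$ is the group with generators $\sigma_1,\dots,\sigma_{n-1},\rho_1,\dots,\rho_{n-1}$ and relations: $\sigma_i\sigma_{i+1}\sigma_i=\sigma_{i+1}\sigma_i\sigma_{i+1}$ ($1\le i\le n-2$); $\sigma_i\sigma_j=\sigma_j\sigma_i$ ($|i-j|>1$); $\rho_i\rho_{i+1}\rho_i=\rho_{i+1}\rho_i\rho_{i+1}$ ($1\le i\le n-2$); $\rho_i\rho_j=\rho_j\rho_i$ ($|i-j|>1$); $\rho_i^2=1$ ($1\le i\le n-1$); $\sigma_i\rho_j=\rho_j\sigma_i$ ($|i-j|>1$); $\sigma_i\rho_{i+1}\rho_i=\rho_{i+1}\rho_i\sigma_{i+1}$ ($1\le i\le n-2$); $\rho_i\sigma_{i+1}\sigma_i=\sigma_{i+1}\sigma_i\rho_{i+1}$ ($1\le i\le n-2$); $\rho_{i+1}\sigma_i\sigma_{i+1}=\sigma_i\sigma_{i+1}\rho_i$ ($1\le i\le n-2$). The unrestricted virtual pure braid group $UVP_n$ is the kernel of the homomorphism $\phi:UVB_n\to S_n$ with $\phi(\sigma_i)=\phi(\rho_i)=(i,i+1)$ for $1\le i\le n-1$. $UVB_n$ is embedded in $Aut(UVP_n)$ by sending $g\in UVB_n$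 to the automorphism $p\mapsto gpg^{-1}$ of $UVP_n$. *)

theory Defs
  imports "HOL-Algebra.Group_Action" "HOL-Algebra.Sym_Groups"
begin

section \<open>Groups given by generators and relations\<close>

text \<open>The letter \<open>(x, True)\<close> stands for the generator \<open>x\<close> and \<open>(x, False)\<close> for its inverse.\<close>

type_synonym 'a word = "('a \<times> bool) list"

definition words :: "'a set \<Rightarrow> 'a word set"
  where "words S = lists (S \<times> UNIV)"

text \<open>A pair \<open>(u, v) \<in> R\<close> is the relation \<open>u = v\<close>.\<close>

inductive_set word_cong :: "'a set \<Rightarrow> ('a word \<times> 'a word) set \<Rightarrow> ('a word \<times> 'a word) set"
  for S :: "'a set" and R :: "('a word \<times> 'a word) set" where
  relation: "(u, v) \<in> R \<Longrightarrow> u \<in> words S \<Longrightarrow> v \<in> words S \<Longrightarrow> (u, v) \<in> word_cong S R"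
| cancel: "x \<in> S \<Longrightarrow> ([(x, b), (x, \<not> b)], []) \<in> word_cong S R"
| refl: "u \<in> words S \<Longrightarrow> (u, u) \<in> word_cong S R"
| sym: "(u, v) \<in> word_cong S R \<Longrightarrow> (v, u) \<in> word_cong S R"
| trans: "(u, v) \<in> word_cong S R \<Longrightarrow> (v, w) \<in> word_cong S R \<Longrightarrow> (u, w) \<in> word_cong S R"
| append: "(u, u') \<in> word_cong S R \<Longrightarrow> (v, v') \<in> word_cong S R
    \<Longrightarrow> (u @ v, u' @ v') \<in> word_cong S R"

definition presented_group :: "'a set \<Rightarrow> ('a word \<times> 'a word) set \<Rightarrow> 'a word set monoid"
  where "presented_group S R =
    \<lparr> carrier = words S // word_cong S R,
      monoid.mult = (\<lambda>A B. \<Union>u\<in>A. \<Union>v\<in>B. word_cong S R `` {u @ v}),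
      one = word_cong S R `` {[]} \<rparr>"

definition word_class :: "'a set \<Rightarrow> ('a word \<times> 'a word) set \<Rightarrow> 'a word \<Rightarrow> 'a word set"
  where "word_class S R u = word_cong S R `` {u}"

lemma words_simps [simp]:
  "[] \<in> words S"
  "(x # u) \<in> words S \<longleftrightarrow> fst x \<in> S \<and> u \<in> words S"
  "u @ v \<in> words S \<longleftrightarrow> u \<in> words S \<and> v \<in> words S"
  "rev u \<in> words S \<longleftrightarrow> u \<in> words S"
  by (auto simp: words_def mem_Times_iff)

lemma word_cong_words: "(u, v) \<in> word_cong S R \<Longrightarrow> u \<in> words S \<and> v \<in> words S"
  by (induction rule: word_cong.induct) auto

lemma equiv_word_cong: "equiv (words S) (word_cong S R)"
  by (intro equivI refl_onI symI transI)
     (auto dest: word_cong_words intro: word_cong.refl word_cong.sym word_cong.trans)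

lemma word_class_eq:
  assumes "u \<in> words S" "v \<in> words S"
  shows "word_class S R u = word_class S R v \<longleftrightarrow> (u, v) \<in> word_cong S R"
  unfolding word_class_def by (rule eq_equiv_class_iff[OF equiv_word_cong assms])

lemma carrier_presented_group: "carrier (presented_group S R) = word_class S R ` words S"
  by (auto simp: presented_group_def quotient_def word_class_def)

lemma one_presented_group: "\<one>\<^bsub>presented_group S R\<^esub> = word_class S R []"
  by (simp add: presented_group_def word_class_def)

lemma mult_presented_group:
  assumes "u \<in> words S" "v \<in> words S"
  shows "word_class S R u \<otimes>\<^bsub>presented_group S R\<^esub> word_class S R v = word_class S R (u @ v)"
proof -
  have *: "word_cong S R `` {u' @ v'} = word_cong S R `` {u @ v}"
    if "u' \<in> word_class S R u" "v' \<in> word_class S R v" for u' v'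
  proof -
    have "(u @ v, u' @ v') \<in> word_cong S R"
      using that by (intro word_cong.append) (simp_all add: word_class_def)
    from equiv_class_eq[OF equiv_word_cong this] show ?thesis by simp
  qed
  have "u \<in> word_class S R u" "v \<in> word_class S R v"
    using assms by (simp_all add: word_class_def word_cong.refl)
  then have ne: "word_class S R u \<noteq> {}" "word_class S R v \<noteq> {}"
    by blast+
  have "(\<Union>u'\<in>word_class S R u. \<Union>v'\<in>word_class S R v. word_cong S R `` {u' @ v'}) =
      (\<Union>u'\<in>word_class S R u. \<Union>v'\<in>word_class S R v. word_cong S R `` {u @ v})"
    by (intro SUP_cong HOL.refl *)
  also have "\<dots> = word_class S R (u @ v)"
    using ne by (simp add: word_class_def)
  finally show ?thesis
    by (simp add: presented_group_def)
qed

definition inv_word :: "'a word \<Rightarrow> 'a word"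
  where "inv_word u = rev (map (\<lambda>(x, b). (x, \<not> b)) u)"

lemma inv_word_words: "u \<in> words S \<Longrightarrow> inv_word u \<in> words S"
  by (auto simp: inv_word_def words_def)

lemma inv_word_cancel: "u \<in> words S \<Longrightarrow> (inv_word u @ u, []) \<in> word_cong S R"
proof (induction u)
  case Nil
  then show ?case by (simp add: inv_word_def word_cong.refl)
next
  case (Cons p u)
  obtain x b where p: "p = (x, b)" by (cases p)
  have u: "x \<in> S" "u \<in> words S" using Cons.prems p by auto
  have "([(x, \<not> b), (x, b)], []) \<in> word_cong S R"
    using word_cong.cancel[OF u(1), of "\<not> b"] by simp
  then have "([(x, \<not> b), (x, b)] @ u, [] @ u) \<in> word_cong S R"
    by (rule word_cong.append) (rule word_cong.refl[OF u(2)])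
  then have "(inv_word u @ ([(x, \<not> b), (x, b)] @ u), inv_word u @ ([] @ u)) \<in> word_cong S R"
    by (rule word_cong.append[OF word_cong.refl[OF inv_word_words[OF u(2)]]])
  from word_cong.trans[OF this, of "[]"] show ?case
    using Cons.IH[OF u(2)] by (simp add: inv_word_def p)
qed

lemma group_presented_group: "group (presented_group S R)"
proof (rule groupI)
  show "x \<otimes>\<^bsub>presented_group S R\<^esub> y \<in> carrier (presented_group S R)"
    if "x \<in> carrier (presented_group S R)" "y \<in> carrier (presented_group S R)" for x y
    using that unfolding carrier_presented_group
    by (elim imageE) (simp add: mult_presented_group)
  show "\<one>\<^bsub>presented_group S R\<^esub> \<in> carrier (presented_group S R)"
    by (simp add: carrier_presented_group one_presented_group)
  show "x \<otimes>\<^bsub>presented_group S R\<^esub> y \<otimes>\<^bsub>presented_group S R\<^esub> z =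
      x \<otimes>\<^bsub>presented_group S R\<^esub> (y \<otimes>\<^bsub>presented_group S R\<^esub> z)"
    if "x \<in> carrier (presented_group S R)" "y \<in> carrier (presented_group S R)"
      "z \<in> carrier (presented_group S R)" for x y z
    using that unfolding carrier_presented_group
    by (elim imageE) (simp add: mult_presented_group)
  show "\<one>\<^bsub>presented_group S R\<^esub> \<otimes>\<^bsub>presented_group S R\<^esub> x = x"
    if "x \<in> carrier (presented_group S R)" for x
    using that unfolding carrier_presented_group
    by (elim imageE) (simp add: mult_presented_group one_presented_group)
  fix x assume "x \<in> carrier (presented_group S R)"
  then obtain u where u: "u \<in> words S" "x = word_class S R u"
    by (auto simp: carrier_presented_group)
  have "word_class S R (inv_word u) \<otimes>\<^bsub>presented_group S R\<^esub> x = \<one>\<^bsub>presented_group S R\<^esub>"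
    using u inv_word_words[OF u(1)] inv_word_cancel[OF u(1), of R]
    by (simp add: mult_presented_group one_presented_group word_class_eq)
  moreover have "word_class S R (inv_word u) \<in> carrier (presented_group S R)"
    using inv_word_words[OF u(1)] by (simp add: carrier_presented_group)
  ultimately show "\<exists>y\<in>carrier (presented_group S R). y \<otimes>\<^bsub>presented_group S R\<^esub> x = \<one>\<^bsub>presented_group S R\<^esub>"
    by blast
qed

text \<open>Evaluation of words in a group \<open>G\<close>, and the induced map on the presented group.
  By \<open>hom_presented_lift\<close> below, the latter is the homomorphism extending \<open>f\<close> whenever
  the relations hold in \<open>G\<close>.\<close>

definition word_eval :: "('b, 'c) monoid_scheme \<Rightarrow> ('a \<Rightarrow> 'b) \<Rightarrow> 'a word \<Rightarrow> 'b"
  where "word_eval G f u =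
    foldr (\<lambda>(x, b) y. (if b then f x else inv\<^bsub>G\<^esub> (f x)) \<otimes>\<^bsub>G\<^esub> y) u \<one>\<^bsub>G\<^esub>"

definition presented_lift :: "('b, 'c) monoid_scheme \<Rightarrow> ('a \<Rightarrow> 'b) \<Rightarrow> 'a word set \<Rightarrow> 'b"
  where "presented_lift G f A = the_elem (word_eval G f ` A)"

lemma (in group) word_eval_closed:
  "f \<in> S \<rightarrow> carrier G \<Longrightarrow> u \<in> words S \<Longrightarrow> word_eval G f u \<in> carrier G"
  by (induction u) (auto simp: word_eval_def dest: funcset_mem)

lemma (in group) word_eval_append:
  "f \<in> S \<rightarrow> carrier G \<Longrightarrow> u \<in> words S \<Longrightarrow> v \<in> words S \<Longrightarrow>
    word_eval G f (u @ v) = word_eval G f u \<otimes> word_eval G f v"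
proof (induction u)
  case Nil
  then show ?case using word_eval_closed[of f S v] by (simp add: word_eval_def)
next
  case (Cons p u)
  obtain x b where p: "p = (x, b)" by (cases p)
  have c: "word_eval G f u \<in> carrier G" "word_eval G f v \<in> carrier G" "f x \<in> carrier G"
    using Cons.prems p by (auto intro: word_eval_closed)
  have step: "word_eval G f (p # w) = (if b then f x else inv (f x)) \<otimes> word_eval G f w" for w
    by (simp add: word_eval_def p)
  show ?case
    using Cons c by (simp add: step m_assoc)
qed

lemma (in group) word_eval_cong:
  assumes f: "f \<in> S \<rightarrow> carrier G"
    and R: "\<And>u v. (u, v) \<in> R \<Longrightarrow> word_eval G f u = word_eval G f v"
  shows "(u, v) \<in> word_cong S R \<Longrightarrow> word_eval G f u = word_eval G f v"
proof (induction rule: word_cong.induct)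
  case (cancel x b)
  then have "f x \<in> carrier G" using f by auto
  then show ?case by (simp add: word_eval_def)
next
  case (append u u' v v')
  then show ?case
    using word_cong_words[OF append.hyps(1)] word_cong_words[OF append.hyps(2)]
    by (simp add: word_eval_append[OF f])
qed (auto simp: R)

lemma (in group) presented_lift_word_class:
  assumes "f \<in> S \<rightarrow> carrier G"
    and "\<And>u v. (u, v) \<in> R \<Longrightarrow> word_eval G f u = word_eval G f v"
    and u: "u \<in> words S"
  shows "presented_lift G f (word_class S R u) = word_eval G f u"
proof -
  have "word_eval G f ` word_class S R u = {word_eval G f u}"
  proof (intro equalityI subsetI)
    fix y assume "y \<in> word_eval G f ` word_class S R u"
    then obtain v where "(u, v) \<in> word_cong S R" "y = word_eval G f v"
      by (auto simp: word_class_def)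
    then show "y \<in> {word_eval G f u}"
      using word_eval_cong[OF assms(1,2)] by simp
  next
    fix y assume "y \<in> {word_eval G f u}"
    moreover have "u \<in> word_class S R u"
      using word_cong.refl[OF u] by (simp add: word_class_def)
    ultimately show "y \<in> word_eval G f ` word_class S R u" by blast
  qed
  then show ?thesis by (simp add: presented_lift_def)
qed

lemma (in group) hom_presented_lift:
  assumes "f \<in> S \<rightarrow> carrier G"
    and "\<And>u v. (u, v) \<in> R \<Longrightarrow> word_eval G f u = word_eval G f v"
  shows "presented_lift G f \<in> hom (presented_group S R) G"
    and "x \<in> S \<Longrightarrow> presented_lift G f (word_class S R [(x, True)]) = f x"
proof -
  note lift = presented_lift_word_class[OF assms]
  show "presented_lift G f \<in> hom (presented_group S R) G"
    by (rule homI)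
       (auto simp: carrier_presented_group mult_presented_group lift
          word_eval_append[OF assms(1)] intro: word_eval_closed[OF assms(1)])
  assume "x \<in> S"
  then have "[(x, True)] \<in> words S" "f x \<in> carrier G"
    using assms(1) by auto
  then show "presented_lift G f (word_class S R [(x, True)]) = f x"
    by (subst lift) (auto simp: word_eval_def)
qed


section \<open>The unrestricted virtual braid group and its pure subgroup\<close>

datatype uvb_gen = Sigma nat | Rho nat

definition uvb_gens :: "nat \<Rightarrow> uvb_gen set"
  where "uvb_gens n = Sigma ` {1..<n} \<union> Rho ` {1..<n}"

abbreviation sg :: "nat \<Rightarrow> uvb_gen \<times> bool" where "sg i \<equiv> (Sigma i, True)"
abbreviation rh :: "nat \<Rightarrow> uvb_gen \<times> bool" where "rh i \<equiv> (Rho i, True)"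

definition uvb_rels :: "nat \<Rightarrow> (uvb_gen word \<times> uvb_gen word) set"
  where "uvb_rels n =
    {([sg i, sg (i+1), sg i], [sg (i+1), sg i, sg (i+1)]) | i. 1 \<le> i \<and> i + 2 \<le> n} \<union>
    {([sg i, sg j], [sg j, sg i]) | i j. i \<in> {1..<n} \<and> j \<in> {1..<n} \<and> \<bar>int i - int j\<bar> > 1} \<union>
    {([rh i, rh (i+1), rh i], [rh (i+1), rh i, rh (i+1)]) | i. 1 \<le> i \<and> i + 2 \<le> n} \<union>
    {([rh i, rh j], [rh j, rh i]) | i j. i \<in> {1..<n} \<and> j \<in> {1..<n} \<and> \<bar>int i - int j\<bar> > 1} \<union>
    {([rh i, rh i], []) | i. i \<in> {1..<n}} \<union>
    {([sg i, rh j], [rh j, sg i]) | i j. i \<in> {1..<n} \<and> j \<in> {1..<n} \<and> \<bar>int i - int j\<bar> > 1} \<union>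
    {([sg i, rh (i+1), rh i], [rh (i+1), rh i, sg (i+1)]) | i. 1 \<le> i \<and> i + 2 \<le> n} \<union>
    {([rh i, sg (i+1), sg i], [sg (i+1), sg i, rh (i+1)]) | i. 1 \<le> i \<and> i + 2 \<le> n} \<union>
    {([rh (i+1), sg i, sg (i+1)], [sg i, sg (i+1), rh i]) | i. 1 \<le> i \<and> i + 2 \<le> n}"

definition UVB :: "nat \<Rightarrow> uvb_gen word set monoid"
  where "UVB n = presented_group (uvb_gens n) (uvb_rels n)"

fun uvb_gen_perm :: "uvb_gen \<Rightarrow> nat \<Rightarrow> nat" where
  "uvb_gen_perm (Sigma i) = transpose i (i + 1)"
| "uvb_gen_perm (Rho i) = transpose i (i + 1)"

definition uvb_perm :: "nat \<Rightarrow> uvb_gen word set \<Rightarrow> nat \<Rightarrow> nat"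
  where "uvb_perm n = presented_lift (sym_group n) uvb_gen_perm"

definition UVP :: "nat \<Rightarrow> uvb_gen word set monoid"
  where "UVP n = (UVB n)\<lparr>carrier := kernel (UVB n) (sym_group n) (uvb_perm n)\<rparr>"

definition uvb_conj :: "nat \<Rightarrow> uvb_gen word set \<Rightarrow> uvb_gen word set \<Rightarrow> uvb_gen word set"
  where "uvb_conj n g = (\<lambda>p \<in> carrier (UVP n). g \<otimes>\<^bsub>UVB n\<^esub> p \<otimes>\<^bsub>UVB n\<^esub> inv\<^bsub>UVB n\<^esub> g)"

definition UVB_in_Aut :: "nat \<Rightarrow> (uvb_gen word set \<Rightarrow> uvb_gen word set) set"
  where "UVB_in_Aut n = uvb_conj n ` carrier (UVB n)"

lemma group_UVB: "group (UVB n)"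
  unfolding UVB_def by (rule group_presented_group)

lemma uvb_rels_words: "(u, v) \<in> uvb_rels n \<Longrightarrow> u \<in> words (uvb_gens n) \<and> v \<in> words (uvb_gens n)"
  by (auto simp: uvb_rels_def uvb_gens_def)

lemma uvb_gen_perm_closed: "uvb_gen_perm \<in> uvb_gens n \<rightarrow> carrier (sym_group n)"
  by (auto simp: uvb_gens_def sym_group_carrier intro!: permutes_swap_id)

lemma uvb_gen_perm_rels:
  assumes "(u, v) \<in> uvb_rels n"
  shows "word_eval (sym_group n) uvb_gen_perm u = word_eval (sym_group n) uvb_gen_perm v"
proof -
  define T :: "nat \<Rightarrow> nat \<Rightarrow> nat" where "T i = transpose i (i + 1)" for i
  have eval: "word_eval (sym_group n) uvb_gen_perm [] = id"
    "word_eval (sym_group n) uvb_gen_perm (sg i # w) = T i \<circ> word_eval (sym_group n) uvb_gen_perm w"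
    "word_eval (sym_group n) uvb_gen_perm (rh i # w) = T i \<circ> word_eval (sym_group n) uvb_gen_perm w"
    for i w
    by (simp_all add: word_eval_def sym_group_mult sym_group_one T_def)
  have invol: "T i \<circ> T i = id" for i
    by (simp add: T_def)
  have braid: "T i \<circ> (T (i + 1) \<circ> T i) = T (i + 1) \<circ> (T i \<circ> T (i + 1))" for i
  proof
    fix x
    consider "x = i" | "x = i + 1" | "x = i + 2" | "x \<noteq> i" "x \<noteq> i + 1" "x \<noteq> i + 2"
      by blast
    then show "(T i \<circ> (T (i + 1) \<circ> T i)) x = (T (i + 1) \<circ> (T i \<circ> T (i + 1))) x"
      by cases (simp_all add: T_def transpose_def)
  qed
  have comm: "T i \<circ> T j = T j \<circ> T i" if "\<bar>int i - int j\<bar> > 1" for i j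
  proof
    fix x
    have "i \<noteq> j" "i + 1 \<noteq> j" "i \<noteq> j + 1"
      using that by auto
    moreover consider "x = i" | "x = i + 1" | "x = j" | "x = j + 1"
      | "x \<noteq> i" "x \<noteq> i + 1" "x \<noteq> j" "x \<noteq> j + 1"
      by blast
    ultimately show "(T i \<circ> T j) x = (T j \<circ> T i) x"
      by cases (simp_all add: T_def transpose_def)
  qed
  show ?thesis
    using assms unfolding uvb_rels_def
    by (elim UnE; elim CollectE exE conjE Pair_inject; hypsubst; simp only: eval comp_id)
      (erule comm | rule invol braid braid[symmetric])+
qed

lemma uvb_perm_hom: "uvb_perm n \<in> hom (UVB n) (sym_group n)"
  unfolding uvb_perm_def UVB_def
  by (rule group.hom_presented_lift[OF sym_group_is_group uvb_gen_perm_closed uvb_gen_perm_rels])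

lemma uvb_perm_gen:
  assumes "i \<in> {1..<n}"
  shows "uvb_perm n (word_class (uvb_gens n) (uvb_rels n) [sg i]) = transpose i (i + 1)"
    and "uvb_perm n (word_class (uvb_gens n) (uvb_rels n) [rh i]) = transpose i (i + 1)"
proof -
  have "uvb_perm n (word_class (uvb_gens n) (uvb_rels n) [(x, True)]) = uvb_gen_perm x"
    if "x \<in> uvb_gens n" for x
    unfolding uvb_perm_def
    by (rule group.hom_presented_lift(2)[OF sym_group_is_group uvb_gen_perm_closed uvb_gen_perm_rels that])
  from this[of "Sigma i"] this[of "Rho i"] assms
  show "uvb_perm n (word_class (uvb_gens n) (uvb_rels n) [sg i]) = transpose i (i + 1)"
    and "uvb_perm n (word_class (uvb_gens n) (uvb_rels n) [rh i]) = transpose i (i + 1)"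
    by (simp_all add: uvb_gens_def)
qed

lemma group_hom_uvb_perm: "group_hom (UVB n) (sym_group n) (uvb_perm n)"
  by (intro group_hom.intro group_hom_axioms.intro group_UVB sym_group_is_group uvb_perm_hom)

lemma normal_UVP: "carrier (UVP n) \<lhd> UVB n"
  using group_hom.normal_kernel[OF group_hom_uvb_perm] by (simp add: UVP_def)

lemma group_UVP: "group (UVP n)"
  using subgroup.subgroup_is_group[OF group_hom.subgroup_kernel[OF group_hom_uvb_perm] group_UVB]
  by (simp add: UVP_def)

lemma uvb_conj_hom: "uvb_conj n \<in> hom (UVB n) (AutoGroup (UVP n))"
proof -
  interpret G: group "UVB n" by (rule group_UVB)
  interpret N: normal "carrier (UVP n)" "UVB n" by (rule normal_UVP)
  let ?P = "carrier (UVP n)"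
  have P: "p \<in> carrier (UVB n)" if "p \<in> ?P" for p
    using that N.subset by blast
  have mP: "monoid.mult (UVP n) = monoid.mult (UVB n)"
    by (simp add: UVP_def)
  have closed: "uvb_conj n g p \<in> ?P" if "g \<in> carrier (UVB n)" "p \<in> ?P" for g p
    using that N.inv_op_closed2 by (simp add: uvb_conj_def)
  have comp: "uvb_conj n (g \<otimes>\<^bsub>UVB n\<^esub> h) = compose ?P (uvb_conj n g) (uvb_conj n h)"
    if "g \<in> carrier (UVB n)" "h \<in> carrier (UVB n)" for g h
  proof
    fix p
    show "uvb_conj n (g \<otimes>\<^bsub>UVB n\<^esub> h) p = compose ?P (uvb_conj n g) (uvb_conj n h) p"
    proof (cases "p \<in> ?P")
      case True
      have "h \<otimes>\<^bsub>UVB n\<^esub> p \<otimes>\<^bsub>UVB n\<^esub> inv\<^bsub>UVB n\<^esub> h \<in> ?P"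
        using N.inv_op_closed2 that True by blast
      then show ?thesis
        using True that P[OF True]
        by (simp add: uvb_conj_def compose_def G.inv_mult_group G.m_assoc)
    qed (simp add: uvb_conj_def compose_def)
  qed
  have one: "uvb_conj n \<one>\<^bsub>UVB n\<^esub> = (\<lambda>p\<in>?P. p)"
    by (rule ext) (auto simp: uvb_conj_def P)
  have bij: "bij_betw (uvb_conj n g) ?P ?P" if g: "g \<in> carrier (UVB n)" for g
  proof (rule bij_betw_byWitness[where f' = "uvb_conj n (inv\<^bsub>UVB n\<^esub> g)"])
    have "compose ?P (uvb_conj n (inv\<^bsub>UVB n\<^esub> g)) (uvb_conj n g) = (\<lambda>p\<in>?P. p)"
      "compose ?P (uvb_conj n g) (uvb_conj n (inv\<^bsub>UVB n\<^esub> g)) = (\<lambda>p\<in>?P. p)"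
      using g one by (simp_all flip: comp)
    then show "\<forall>a\<in>?P. uvb_conj n (inv\<^bsub>UVB n\<^esub> g) (uvb_conj n g a) = a"
      "\<forall>a\<in>?P. uvb_conj n g (uvb_conj n (inv\<^bsub>UVB n\<^esub> g) a) = a"
      by (metis compose_eq restrict_apply')+
  qed (use g closed in auto)
  have hom: "uvb_conj n g \<in> hom (UVP n) (UVP n)" if g: "g \<in> carrier (UVB n)" for g
  proof (rule homI)
    fix p q assume p: "p \<in> ?P" and q: "q \<in> ?P"
    have pq: "p \<otimes>\<^bsub>UVB n\<^esub> q \<in> ?P" using p q N.m_closed by blast
    have "inv\<^bsub>UVB n\<^esub> g \<otimes>\<^bsub>UVB n\<^esub> (g \<otimes>\<^bsub>UVB n\<^esub> x) = x" if "x \<in> carrier (UVB n)" for x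
      using g that by (simp flip: G.m_assoc)
    then show "uvb_conj n g (p \<otimes>\<^bsub>UVP n\<^esub> q) = uvb_conj n g p \<otimes>\<^bsub>UVP n\<^esub> uvb_conj n g q"
      using p q pq g P by (simp add: mP uvb_conj_def G.m_assoc)
  qed (use g closed in auto)
  have ext: "uvb_conj n g \<in> extensional ?P" for g
    by (simp add: uvb_conj_def)
  have auto: "uvb_conj n g \<in> auto (UVP n)" if "g \<in> carrier (UVB n)" for g
    using hom[OF that] bij[OF that] ext by (simp add: auto_def Bij_def)
  show ?thesis
  proof (rule homI)
    fix g h assume gh: "g \<in> carrier (UVB n)" "h \<in> carrier (UVB n)"
    then show "uvb_conj n (g \<otimes>\<^bsub>UVB n\<^esub> h) = uvb_conj n g \<otimes>\<^bsub>AutoGroup (UVP n)\<^esub> uvb_conj n h"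
      using auto[OF gh(1)] auto[OF gh(2)] comp[OF gh]
      by (simp add: AutoGroup_def BijGroup_def auto_def)
  qed (use auto in \<open>simp add: AutoGroup_def\<close>)
qed

lemma subgroup_UVB_in_Aut: "subgroup (UVB_in_Aut n) (AutoGroup (UVP n))"
proof -
  have "group_hom (UVB n) (AutoGroup (UVP n)) (uvb_conj n)"
    by (intro group_hom.intro group_hom_axioms.intro group_UVB uvb_conj_hom
        group.AutoGroup[OF group_UVP])
  from group_hom.img_is_subgroup[OF this] show ?thesis
    by (simp add: UVB_in_Aut_def)
qed

end

theory Submission
  imports Defs "HOL-Algebra.Multiplicative_Group"
begin

text \<open>Write \<open>G\<close> for the unrestricted virtual braid group and \<open>P\<close> for its pure subgroup.

\<^bold>\<open>Reduction.\<close> An automorphism of \<open>G\<close> that maps \<open>P\<close> onto itself restricts to an automorphism of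
\<open>P\<close>, and the restriction normalizes the group of conjugations by elements of \<open>G\<close>. If only the
identity of \<open>G\<close> centralizes \<open>P\<close>, nothing is lost: an automorphism that is the identity on \<open>P\<close>
changes every element of \<open>G\<close> by a factor that centralizes \<open>P\<close>, and an automorphism \<open>h\<close> of \<open>P\<close>
that normalizes \<open>G\<close> extends to \<open>G\<close>, since it carries conjugation by \<open>g\<close> to conjugation by a unique
\<open>g'\<close>. So it is enough that \<open>P\<close> is characteristic and has trivial centralizer
(\<open>Aut_iso_normalizer\<close>).

\<^bold>\<open>Structure of the group.\<close> Let \<open>lam i j\<close> be the conjugate of \<open>\<sigma> 1 \<rho> 1\<close> by any word in the \<open>\<rho>\<close>'s whose
permutation sends \<open>1, 2\<close> to \<open>i, j\<close>. The \<open>\<rho>\<close>'s satisfy no relations beyond those of the symmetric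
group (\<open>inj_perm\<close>), so \<open>P\<close> is generated by the \<open>lam i j\<close> (\<open>kernel_eq_ev\<close>), and the defining
relations say that \<open>lam i j\<close> and \<open>lam k l\<close> commute unless \<open>{i, j} = {k, l}\<close> (\<open>commute_lam\<close>). Thus \<open>P\<close>
is a product of commuting subgroups \<open>\<langle>lam i j, lam j i\<rangle>\<close>, one for each pair. These subgroups are free
and the product is direct. To see this, let \<open>G\<close> act on points \<open>(a, b, x, y)\<close>: each \<open>\<rho>\<close> permutes
the block \<open>(a, b)\<close>, while \<open>lam i j\<close> shears the plane of the block \<open>(i, j)\<close> by \<open>x \<mapsto> x + 2y\<close> and that of
\<open>(j, i)\<close> by \<open>y \<mapsto> y + 2x\<close>. By ping-pong for these two shears, an element of \<open>P\<close> that acts on every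
block by a scalar is trivial (\<open>scalar_everywhere_trivial\<close>).

\<^bold>\<open>Trivial centralizer.\<close> An element that commutes with all \<open>lam i j\<close> preserves every pair \<open>{i, j}\<close>,
hence is pure, and commutes with two transversal shears in each block, hence is scalar there
(\<open>pure_centralizer\<close>).

\<^bold>\<open>Characteristic.\<close> Let \<open>m\<close> be the order of the symmetric group, so that \<open>m\<close>-th powers are pure. Then
\<open>g\<close> is pure if and only if for every \<open>m\<close>-th power \<open>x \<noteq> 1\<close> some conjugate of \<open>x\<close> by an \<open>m\<close>-th power
does not commute with \<open>g x g\<^sup>-\<^sup>1\<close> (\<open>pure_iff_separated\<close>), and automorphisms respect this condition.
If \<open>g\<close> is pure, then \<open>x\<close> and \<open>g x g\<^sup>-\<^sup>1\<close> are both non-scalar on a common block, and conjugation by a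
power of one of the two shears of that block destroys commutation. If \<open>g\<close> is not pure, it moves a
pair \<open>{i, j}\<close>; the conjugates of \<open>x = (lam i j)\<^sup>m\<close> by pure elements live on the blocks of \<open>{i, j}\<close>,
\<open>g x g\<^sup>-\<^sup>1\<close> lives on other blocks, and so they always commute.\<close>

section \<open>Extending automorphisms of a characteristic subgroup\<close>

lemma carrier_AutoGroup: "carrier (AutoGroup G) = auto G"
  by (simp add: AutoGroup_def)

lemma mult_AutoGroup:
  assumes "f \<in> auto G" "g \<in> auto G"
  shows "f \<otimes>\<^bsub>AutoGroup G\<^esub> g = compose (carrier G) f g"
  using assms by (simp add: AutoGroup_def BijGroup_def auto_def)

lemma
  assumes "f \<in> auto G"
  shows auto_closed: "x \<in> carrier G \<Longrightarrow> f x \<in> carrier G"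
    and auto_mult: "x \<in> carrier G \<Longrightarrow> y \<in> carrier G \<Longrightarrow> f (x \<otimes>\<^bsub>G\<^esub> y) = f x \<otimes>\<^bsub>G\<^esub> f y"
    and auto_bij: "bij_betw f (carrier G) (carrier G)"
    and auto_ext: "f \<in> extensional (carrier G)"
  using assms by (auto simp: auto_def Bij_def hom_def)

lemma (in group) auto_inv:
  assumes "f \<in> auto G" "x \<in> carrier G"
  shows "f (inv x) = inv (f x)"
proof -
  interpret group_hom G G f
    using assms(1) by unfold_locales (simp add: auto_def)
  show ?thesis using assms(2) by simp
qed

lemma (in group) conj_eq_iff:
  assumes "x \<in> carrier G" "y \<in> carrier G" "z \<in> carrier G"
  shows "x \<otimes> y \<otimes> inv x = z \<longleftrightarrow> x \<otimes> y = z \<otimes> x"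
  using assms by (metis inv_solve_right m_closed)

lemma (in group) in_normalizer_iff:
  assumes "H \<subseteq> carrier G"
  shows "g \<in> normalizer G H \<longleftrightarrow> g \<in> carrier G \<and> (\<lambda>h. g \<otimes> h \<otimes> inv g) ` H = H"
proof -
  have "g <# H #> inv g = (\<lambda>h. g \<otimes> h \<otimes> inv g) ` H"
    by (auto simp: l_coset_def r_coset_def)
  then show ?thesis
    using assms by (simp add: normalizer_def stabilizer_def)
qed

text \<open>The isomorphism is restriction to \<open>N\<close>. A trivial centralizer makes \<open>c\<close> injective, which gives both
injectivity (an automorphism \<open>f\<close> is recovered from its restriction \<open>r f\<close>, because conjugating \<open>c g\<close>
by \<open>r f\<close> yields \<open>c (f g)\<close>) and the extension of a normalizing automorphism.\<close>

lemma (in group) Aut_iso_normalizer: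
  fixes N c
  defines "P \<equiv> G\<lparr>carrier := N\<rparr>"
  assumes N: "N \<lhd> G"
    and c_hom: "c \<in> hom G (AutoGroup P)"
    and c_app: "\<And>g p. g \<in> carrier G \<Longrightarrow> p \<in> N \<Longrightarrow> c g p = g \<otimes> p \<otimes> inv g"
    and characteristic: "\<And>f. f \<in> auto G \<Longrightarrow> f ` N = N"
    and centralizer: "\<And>g. g \<in> carrier G \<Longrightarrow> (\<And>p. p \<in> N \<Longrightarrow> g \<otimes> p = p \<otimes> g) \<Longrightarrow> g = \<one>"
  shows "AutoGroup G \<cong> (AutoGroup P)\<lparr>carrier := normalizer (AutoGroup P) (c ` carrier G)\<rparr>"
proof -
  interpret N: normal N G by (rule N)
  have gP: "group P"
    unfolding P_def using N.subgroup_axioms by (rule subgroup.subgroup_is_group) (rule is_group)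
  interpret P: group P by (rule gP)
  define A where "A = AutoGroup P"
  interpret A: group A unfolding A_def by (rule P.AutoGroup)
  interpret c: group_hom G A c
    using c_hom by unfold_locales (simp add: A_def)
  have cP [simp]: "carrier P = N" and mP [simp]: "monoid.mult P = monoid.mult G"
    by (simp_all add: P_def)
  have cA: "carrier A = auto P" by (simp add: A_def carrier_AutoGroup)
  have mA: "f \<otimes>\<^bsub>A\<^esub> g = compose N f g" if "f \<in> carrier A" "g \<in> carrier A" for f g
    using mult_AutoGroup[of f P g] that by (simp add: A_def carrier_AutoGroup)
  have NG: "p \<in> carrier G" if "p \<in> N" for p using that N.subset by blast
  have conjN: "g \<otimes> p \<otimes> inv g \<in> N" if "g \<in> carrier G" "p \<in> N" for g p
    using that N.inv_op_closed2 by blast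
  have extA: "f = h" if "f \<in> carrier A" "h \<in> carrier A" "\<And>p. p \<in> N \<Longrightarrow> f p = h p" for f h
    using that auto_ext[of f P] auto_ext[of h P] by (auto simp: cA intro: extensionalityI)

  have c_inj: "inj_on c (carrier G)"
  proof (rule c.inj_iff_trivial_ker[THEN iffD2], rule equalityI; rule subsetI)
    fix g assume "g \<in> kernel G A c"
    then have g: "g \<in> carrier G" and "c g = \<one>\<^bsub>A\<^esub>" by (auto simp: kernel_def)
    then have "c g = c \<one>" by simp
    have "g \<otimes> p = p \<otimes> g" if "p \<in> N" for p
    proof -
      have "g \<otimes> p \<otimes> inv g = \<one> \<otimes> p \<otimes> inv \<one>"
        using c_app[OF g that] c_app[OF one_closed that] \<open>c g = c \<one>\<close> by simp
      then show ?thesis using g NG[OF that] by (simp add: conj_eq_iff)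
    qed
    then show "g \<in> {\<one>}" using centralizer[OF g] by simp
  qed (auto simp: kernel_def)

  define r where "r f = restrict f N" for f :: "'a \<Rightarrow> 'a"
  have r_app [simp]: "r f p = f p" if "p \<in> N" for f p
    using that by (simp add: r_def)
  have r_auto: "r f \<in> carrier A" if f: "f \<in> auto G" for f
  proof -
    have "f \<in> hom G G" using f by (simp add: auto_def)
    have "r f \<in> hom P P"
    proof (rule homI)
      fix x y assume "x \<in> carrier P" "y \<in> carrier P"
      then show "r f (x \<otimes>\<^bsub>P\<^esub> y) = r f x \<otimes>\<^bsub>P\<^esub> r f y"
        using auto_mult[OF f, of x y] by (simp add: NG N.m_closed)
    qed (use characteristic[OF f] in \<open>auto simp: r_def\<close>)
    moreover have "bij_betw f N N"
      using characteristic[OF f] auto_bij[OF f] N.subset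
      by (auto simp: bij_betw_def intro: inj_on_subset)
    then have "bij_betw (r f) N N"
      unfolding r_def by (subst bij_betw_restrict_eq)
    ultimately show ?thesis by (simp add: cA auto_def Bij_def r_def)
  qed
  have r_conj: "r f \<otimes>\<^bsub>A\<^esub> c g = c (f g) \<otimes>\<^bsub>A\<^esub> r f"
    if f: "f \<in> auto G" and g: "g \<in> carrier G" for f g
  proof (rule extA)
    fix p assume p: "p \<in> N"
    have fp: "f p \<in> N" using characteristic[OF f] p by blast
    have "f (g \<otimes> p \<otimes> inv g) = f g \<otimes> f p \<otimes> inv (f g)"
      using f g NG[OF p] by (simp add: auto_closed auto_mult auto_inv)
    then show "(r f \<otimes>\<^bsub>A\<^esub> c g) p = (c (f g) \<otimes>\<^bsub>A\<^esub> r f) p"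
      using p g fp auto_closed[OF f g]
      by (simp add: mA[OF r_auto[OF f] c.hom_closed] mA[OF c.hom_closed r_auto[OF f]]
          compose_eq c_app conjN)
  qed (use r_auto[OF f] g auto_closed[OF f g] in auto)
  have r_normalizes: "r f \<in> normalizer A (c ` carrier G)" if f: "f \<in> auto G" for f
  proof -
    have "(\<lambda>h. r f \<otimes>\<^bsub>A\<^esub> h \<otimes>\<^bsub>A\<^esub> inv\<^bsub>A\<^esub> r f) ` c ` carrier G = c ` f ` carrier G"
      unfolding image_image
    proof (rule image_cong[OF HOL.refl])
      fix g assume g: "g \<in> carrier G"
      show "r f \<otimes>\<^bsub>A\<^esub> c g \<otimes>\<^bsub>A\<^esub> inv\<^bsub>A\<^esub> r f = c (f g)"
        using r_conj[OF f g] r_auto[OF f] g auto_closed[OF f g]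
        by (intro A.conj_eq_iff[THEN iffD2]) simp_all
    qed
    also have "f ` carrier G = carrier G"
      using auto_bij[OF f] by (simp add: bij_betw_def)
    finally show ?thesis
      using r_auto[OF f] by (subst A.in_normalizer_iff) auto
  qed
  have r_outside: "r f p = undefined" if "p \<notin> N" for f p
    using that by (simp add: r_def)
  have r_mult: "r (f \<otimes>\<^bsub>AutoGroup G\<^esub> h) = r f \<otimes>\<^bsub>A\<^esub> r h" if f: "f \<in> auto G" and h: "h \<in> auto G" for f h
  proof
    fix p
    have "p \<in> N \<Longrightarrow> h p \<in> N" using characteristic[OF h] by blast
    then show "r (f \<otimes>\<^bsub>AutoGroup G\<^esub> h) p = (r f \<otimes>\<^bsub>A\<^esub> r h) p"
      using NG
      by (cases "p \<in> N")
         (simp_all add: mult_AutoGroup[OF f h] mA[OF r_auto[OF f] r_auto[OF h]] r_outside compose_def)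
  qed
  have r_inj: "inj_on r (auto G)"
  proof (rule inj_onI)
    fix f h assume f: "f \<in> auto G" and h: "h \<in> auto G" and eq: "r f = r h"
    show "f = h"
    proof (rule extensionalityI[OF auto_ext[OF f] auto_ext[OF h]])
      fix g assume g: "g \<in> carrier G"
      have "c (f g) \<otimes>\<^bsub>A\<^esub> r f = c (h g) \<otimes>\<^bsub>A\<^esub> r f"
        using r_conj[OF f g] r_conj[OF h g] eq by simp
      then have "c (f g) = c (h g)"
        using r_auto[OF f] auto_closed[OF f g] auto_closed[OF h g] by simp
      then show "f g = h g"
        using c_inj auto_closed[OF f g] auto_closed[OF h g] by (simp add: inj_on_def)
    qed
  qed
  have r_surj: "\<exists>f \<in> auto G. r f = h" if h: "h \<in> normalizer A (c ` carrier G)" for h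
  proof -
    define k where "k g = h \<otimes>\<^bsub>A\<^esub> c g \<otimes>\<^bsub>A\<^esub> inv\<^bsub>A\<^esub> h" for g
    have hA: "h \<in> carrier A" and kim: "k ` carrier G = c ` carrier G"
      using h by (subst (asm) A.in_normalizer_iff; auto simp: k_def image_image)+
    \<comment> \<open>Conjugation by \<open>h\<close> permutes the image of \<open>c\<close>; pulling this permutation back along \<open>c\<close>
      gives the extension of \<open>h\<close>.\<close>
    define f where "f = (\<lambda>g\<in>carrier G. the_inv_into (carrier G) c (k g))"
    have cf: "c (f g) = k g" and f_closed: "f g \<in> carrier G" if "g \<in> carrier G" for g
      using that kim c_inj
      by (auto simp: f_def intro!: f_the_inv_into_f the_inv_into_into)
    have k_mult: "k (x \<otimes> y) = k x \<otimes>\<^bsub>A\<^esub> k y" if "x \<in> carrier G" "y \<in> carrier G" for x y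
    proof -
      have "inv\<^bsub>A\<^esub> h \<otimes>\<^bsub>A\<^esub> (h \<otimes>\<^bsub>A\<^esub> z) = z" if "z \<in> carrier A" for z
        using that hA by (simp add: A.m_assoc[symmetric])
      then show ?thesis using that hA by (simp add: k_def A.m_assoc)
    qed
    have f_hom: "f (x \<otimes> y) = f x \<otimes> f y" if "x \<in> carrier G" "y \<in> carrier G" for x y
      using that by (intro inj_onD[OF c_inj]) (simp_all add: cf f_closed k_mult)
    have k_inj: "inj_on k (carrier G)"
      using c_inj hA by (auto simp: inj_on_def k_def)
    have f_inj: "inj_on f (carrier G)"
      using k_inj cf by (metis inj_on_def)
    have "g \<in> f ` carrier G" if g: "g \<in> carrier G" for g
    proof -
      obtain g' where g': "g' \<in> carrier G" "k g' = c g" using kim g by (metis imageE imageI)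
      then have "f g' = g" using c_inj cf f_closed g by (metis inj_onD)
      then show ?thesis using g' by blast
    qed
    moreover have "f \<in> extensional (carrier G)" by (simp add: f_def)
    ultimately have fG: "f \<in> auto G"
      using f_hom f_inj f_closed by (auto simp: auto_def Bij_def hom_def bij_betw_def)
    have "f p = h p" if p: "p \<in> N" for p
    proof (rule inj_onD[OF c_inj])
      have hp: "h x \<in> N" if "x \<in> N" for x using auto_closed[of h P] hA that by (simp add: cA)
      have "c (h p) \<otimes>\<^bsub>A\<^esub> h = h \<otimes>\<^bsub>A\<^esub> c p"
      proof (rule extA)
        fix x assume x: "x \<in> N"
        have "inv p = inv\<^bsub>P\<^esub> p" "inv (h p) = inv\<^bsub>P\<^esub> (h p)"
          using m_inv_consistent[OF N.subgroup_axioms] p hp by (simp_all add: P_def)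
        then have "h (p \<otimes> x \<otimes> inv p) = h p \<otimes> h x \<otimes> inv (h p)"
          using p x hA auto_mult[of h P] P.auto_inv[of h p] P.inv_closed[of p] N.m_closed
          by (simp add: cA)
        then show "(c (h p) \<otimes>\<^bsub>A\<^esub> h) x = (h \<otimes>\<^bsub>A\<^esub> c p) x"
          using x p NG hp hA by (simp add: mA compose_eq c_app)
      qed (use NG hp p hA in auto)
      then show "c (f p) = c (h p)"
        using NG hp p hA by (simp add: cf k_def A.conj_eq_iff)
    qed (use NG p f_closed auto_closed[of h P] hA in \<open>auto simp: cA\<close>)
    then have "r f = h"
      by (intro extA[OF r_auto[OF fG] hA]) (simp add: r_def)
    with fG show ?thesis by blast
  qed
  have "r \<in> iso (AutoGroup G) (A\<lparr>carrier := normalizer A (c ` carrier G)\<rparr>)"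
    using r_normalizes r_mult r_inj r_surj
    by (auto simp: iso_def bij_betw_def hom_def carrier_AutoGroup image_iff; metis)
  then show ?thesis unfolding is_iso_def A_def by blast
qed

section \<open>Permutations\<close>

text \<open>Adjacent transpositions generate all transpositions, because
\<open>(c, d + 1) = (d, d + 1) (c, d) (d, d + 1)\<close>, and these generate all permutations.\<close>

lemma permutes_adjacent_induct [consumes 1, case_names id adjacent]:
  fixes a b :: nat
  assumes "s permutes {a..b}"
    and id: "P id"
    and adj: "\<And>i s. a \<le> i \<Longrightarrow> i < b \<Longrightarrow> s permutes {a..b} \<Longrightarrow> P s \<Longrightarrow> P (transpose i (i + 1) \<circ> s)"
  shows "P s"
proof -
  have swap: "P (transpose c (c + k) \<circ> s)" if "a \<le> c" "0 < k" "c + k \<le> b" "s permutes {a..b}" "P s" for c k s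
    using that
  proof (induction k arbitrary: s)
    case (Suc k)
    let ?t = "transpose (c + k) (c + k + 1)"
    have t: "?t permutes {a..b}" using Suc.prems by (intro permutes_swap_id) auto
    show ?case
    proof (cases "k = 0")
      case True
      then show ?thesis using adj[of c s] Suc.prems by (simp del: o_apply add: comp_def)
    next
      case False
      have "P (?t \<circ> (transpose c (c + k) \<circ> (?t \<circ> s)))"
    proof (intro adj Suc.IH)
        show "?t \<circ> s permutes {a..b}" by (rule permutes_compose[OF Suc.prems(4) t])
        then show "transpose c (c + k) \<circ> (?t \<circ> s) permutes {a..b}"
          by (rule permutes_compose) (use Suc.prems in \<open>auto intro!: permutes_swap_id\<close>)
      qed (use Suc.prems False in simp_all)
      also have "?t \<circ> (transpose c (c + k) \<circ> (?t \<circ> s)) = transpose c (c + Suc k) \<circ> s"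
        using transpose_comp_triple[of "c + k + 1" "c" "c + k"] False
        by (simp add: transpose_commute flip: comp_assoc)
      finally show ?thesis .
    qed
  qed simp
  have swap': "P (transpose c d \<circ> s)" if "c \<in> {a..b}" "d \<in> {a..b}" "s permutes {a..b}" "P s" for c d s
  proof -
    consider "c < d" | "c = d" | "d < c" by linarith
    then show ?thesis
    proof cases
      case 1 then show ?thesis using swap[of c "d - c" s] that by simp
    next
      case 2 then show ?thesis using that by simp
    next
      case 3 then show ?thesis using swap[of d "c - d" s] that by (simp add: transpose_commute)
    qed
  qed
  show ?thesis
    using assms(1) finite_atLeastAtMost[of a b]
  proof (induction rule: permutes_induct)
    case id
    show ?case by fact
  next
    case (swap c d p)
    then show ?case using swap' by blast
  qed
qed

text \<open>The permutation is corrected one point at a time: a transposition sends the image of the new point to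
its prescribed value without disturbing the values already attained.\<close>

lemma permutes_map_eq:
  assumes "distinct xs" "distinct ys" "length xs = length ys" "set xs \<subseteq> S" "set ys \<subseteq> S"
  shows "\<exists>s. s permutes S \<and> map s xs = ys"
  using assms(3,1,2,4,5)
proof (induction xs ys rule: list_induct2)
  case Nil
  show ?case by (intro exI[of _ id] conjI permutes_id) simp
next
  case (Cons x xs y ys)
  have "distinct xs" "distinct ys" "set xs \<subseteq> S" "set ys \<subseteq> S"
    using Cons.prems by simp_all
  from Cons.IH[OF this] obtain s where s: "s permutes S" "map s xs = ys" by (elim exE conjE)
  have "x \<notin> set xs" "y \<notin> set ys" "x \<in> S" "y \<in> S"
    using Cons.prems by simp_all
  define r where "r = transpose (s x) y \<circ> s"
  have "s x \<notin> set ys"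
    unfolding s(2)[symmetric] set_map
    using \<open>x \<notin> set xs\<close> permutes_inj[OF s(1)] by (simp add: inj_image_mem_iff)
  have "r z = s z" if "z \<in> set xs" for z
  proof -
    have "s z \<in> set ys" using that s(2) by auto
    then have "s x \<noteq> s z" "y \<noteq> s z"
      using \<open>s x \<notin> set ys\<close> \<open>y \<notin> set ys\<close> by metis+
    then show ?thesis by (simp add: r_def)
  qed
  then have "map r xs = map s xs" by simp
  moreover have "r permutes S"
    unfolding r_def using s(1) \<open>y \<in> S\<close> permutes_in_image[OF s(1)] \<open>x \<in> S\<close>
    by (intro permutes_compose permutes_swap_id) simp_all
  moreover have "r x = y" by (simp add: r_def)
  ultimately have "r permutes S \<and> map r (x # xs) = y # ys" using s(2) by simp
  then show ?case by (intro exI[of _ r])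
qed

section \<open>The Coxeter presentation of the symmetric group\<close>

text \<open>Elements that satisfy the Coxeter relations of the symmetric group and lie over the adjacent
transpositions. The aim is that the relations leave no room for a kernel on the subgroup they generate.\<close>

locale coxeter_generators = group_hom G "sym_group n" \<phi> for G (structure) and n and \<phi> +
  fixes t :: "nat \<Rightarrow> 'a"
  assumes t_closed [simp]: "1 \<le> i \<Longrightarrow> i < n \<Longrightarrow> t i \<in> carrier G"
    and t_square: "1 \<le> i \<Longrightarrow> i < n \<Longrightarrow> t i \<otimes> t i = \<one>"
    and t_commute: "1 \<le> i \<Longrightarrow> i + 1 < j \<Longrightarrow> j < n \<Longrightarrow> t i \<otimes> t j = t j \<otimes> t i"
    and t_braid: "1 \<le> i \<Longrightarrow> i + 1 < n \<Longrightarrow>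
      t i \<otimes> t (i + 1) \<otimes> t i = t (i + 1) \<otimes> t i \<otimes> t (i + 1)"
    and perm_t: "1 \<le> i \<Longrightarrow> i < n \<Longrightarrow> \<phi> (t i) = transpose i (i + 1)"
begin

lemmas [simp] = sym_group_mult sym_group_one

text \<open>The parabolic subgroups of Coxeter theory, for an interval of generators.\<close>

definition par :: "nat \<Rightarrow> nat \<Rightarrow> 'a set"
  where "par a b = generate G (t ` {a..<b})"

lemma inv_t: "1 \<le> i \<Longrightarrow> i < n \<Longrightarrow> inv (t i) = t i"
  using t_square[of i] by (simp add: G.inv_equality)

lemma subgroup_par: "1 \<le> a \<Longrightarrow> b \<le> n \<Longrightarrow> subgroup (par a b) G"
  unfolding par_def by (rule G.generate_is_subgroup) auto

lemma t_in_par: "a \<le> i \<Longrightarrow> i < b \<Longrightarrow> t i \<in> par a b"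
  unfolding par_def by (rule generate.incl) auto

lemma par_closed: "1 \<le> a \<Longrightarrow> b \<le> n \<Longrightarrow> g \<in> par a b \<Longrightarrow> g \<in> carrier G"
  using subgroup.subset[OF subgroup_par] by blast

lemma perm_mult: "g \<in> carrier G \<Longrightarrow> h \<in> carrier G \<Longrightarrow> \<phi> (g \<otimes> h) = \<phi> g \<circ> \<phi> h"
  by simp

lemma perm_one: "\<phi> \<one> = id"
  by simp

lemma permutes_perm: "g \<in> carrier G \<Longrightarrow> \<phi> g permutes {1..n}"
  using hom_closed by (simp add: sym_group_carrier)

lemma par_induct [consumes 3, case_names one t mult]:
  assumes "1 \<le> a" "b \<le> n" "g \<in> par a b"
    and "Q \<one>" "\<And>i. a \<le> i \<Longrightarrow> i < b \<Longrightarrow> Q (t i)"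
    and "\<And>g h. g \<in> par a b \<Longrightarrow> h \<in> par a b \<Longrightarrow> Q g \<Longrightarrow> Q h \<Longrightarrow> Q (g \<otimes> h)"
  shows "Q g"
  using assms(3) unfolding par_def
proof (induction rule: generate.induct)
  case (inv h)
  then show ?case using assms(1,2,5) inv_t by auto
next
  case one
  show ?case by fact
next
  case (incl h)
  then show ?case using assms(5) by auto
next
  case (eng g h)
  then show ?case using assms(6) by (simp add: par_def)
qed

text \<open>The product \<open>t m \<cdots> t j\<close> (empty when \<open>m < j\<close>). These are the representatives of shortest length of the
cosets of \<open>par 1 m\<close> in \<open>par 1 (m + 1)\<close>; the lemmas below say how they absorb or pass a generator on
their right.\<close>

primrec desc :: "nat \<Rightarrow> nat \<Rightarrow> 'a"
  where "desc j 0 = \<one>"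
  | "desc j (Suc m) = (if j \<le> Suc m then t (Suc m) \<otimes> desc j m else \<one>)"

lemma desc_closed [simp]: "1 \<le> j \<Longrightarrow> m < n \<Longrightarrow> desc j m \<in> carrier G"
  by (induction m) auto

lemma desc_empty [simp]: "m < j \<Longrightarrow> desc j m = \<one>"
  by (cases m) auto

lemma desc_snoc: "1 \<le> j \<Longrightarrow> j \<le> m \<Longrightarrow> m < n \<Longrightarrow> desc j m = desc (j + 1) m \<otimes> t j"
proof (induction m)
  case (Suc m)
  then show ?case
    by (cases "j = Suc m") (simp_all add: G.m_assoc)
qed simp

lemma desc_commute_below:
  "1 \<le> i \<Longrightarrow> i + 1 < j \<Longrightarrow> i < n \<Longrightarrow> m < n \<Longrightarrow> desc j m \<otimes> t i = t i \<otimes> desc j m"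
proof (induction m)
  case (Suc m)
  then show ?case
    using t_commute[of i "Suc m"]
    by (cases "j \<le> Suc m") (simp_all add: G.m_assoc, simp add: G.m_assoc[symmetric])
qed simp

lemma desc_commute_above:
  "1 \<le> j \<Longrightarrow> m + 1 < i \<Longrightarrow> i < n \<Longrightarrow> desc j m \<otimes> t i = t i \<otimes> desc j m"
proof (induction m)
  case (Suc m)
  then show ?case
    using t_commute[of "Suc m" i]
    by (simp add: G.m_assoc) (simp add: G.m_assoc[symmetric])
qed simp

lemma desc_shift:
  "1 \<le> j \<Longrightarrow> j < i \<Longrightarrow> i \<le> m \<Longrightarrow> m < n \<Longrightarrow> desc j m \<otimes> t i = t (i - 1) \<otimes> desc j m"
proof (induction m)
  case (Suc m)
  show ?case
  proof (cases "i \<le> m")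
    case True
    then have "desc j (Suc m) \<otimes> t i = t (Suc m) \<otimes> t (i - 1) \<otimes> desc j m"
      using Suc by (simp add: G.m_assoc)
    also have "t (Suc m) \<otimes> t (i - 1) = t (i - 1) \<otimes> t (Suc m)"
      using t_commute[of "i - 1" "Suc m"] Suc.prems True by simp
    finally show ?thesis using Suc.prems True by (simp add: G.m_assoc)
  next
    case False
    then have i: "i = Suc m" using Suc.prems by simp
    then obtain k where k: "m = Suc k" using Suc.prems by (cases m) auto
    have "desc j (Suc m) \<otimes> t i = t (k + 2) \<otimes> t (k + 1) \<otimes> (desc j k \<otimes> t (k + 2))"
      using Suc.prems i k by (simp add: G.m_assoc)
    also have "desc j k \<otimes> t (k + 2) = t (k + 2) \<otimes> desc j k"
      using Suc.prems i k by (intro desc_commute_above) auto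
    also have "t (k + 2) \<otimes> t (k + 1) \<otimes> (t (k + 2) \<otimes> desc j k) =
        t (k + 2) \<otimes> t (k + 1) \<otimes> t (k + 2) \<otimes> desc j k"
      using Suc.prems i k by (simp add: G.m_assoc)
    also have "t (k + 2) \<otimes> t (k + 1) \<otimes> t (k + 2) = t (k + 1) \<otimes> t (k + 2) \<otimes> t (k + 1)"
      using t_braid[of "k + 1"] Suc.prems i k by simp
    finally show ?thesis using Suc.prems i k by (simp add: G.m_assoc)
  qed
qed simp

lemma perm_desc: "1 \<le> j \<Longrightarrow> j \<le> m + 1 \<Longrightarrow> m < n \<Longrightarrow> \<phi> (desc j m) j = m + 1"
proof (induction m)
  case (Suc m)
  then show ?case
    by (cases "j = Suc m + 1") (auto simp: perm_t)
qed simp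

text \<open>The set of all products \<open>h (desc j m)\<close> contains the identity and is closed under multiplication by
generators on the right: depending on the position of \<open>i\<close> relative to \<open>j\<close>, the factor \<open>t i\<close> lengthens
or shortens the descending product, or passes through it into \<open>par 1 m\<close>.\<close>

lemma par_normal_form:
  assumes m: "m < n" and g: "g \<in> par 1 (m + 1)"
  shows "\<exists>h\<in>par 1 m. \<exists>j\<in>{1..m + 1}. g = h \<otimes> desc j m"
proof -
  define T where "T = {h \<otimes> desc j m | h j. h \<in> par 1 m \<and> j \<in> {1..m + 1}}"
  have TI: "h \<otimes> desc j m \<in> T" if "h \<in> par 1 m" "1 \<le> j" "j \<le> m + 1" for h j
    using that by (auto simp: T_def)
  interpret par: subgroup "par 1 m" G using m by (intro subgroup_par) auto
  have "1 \<le> (1::nat)" "m + 1 \<le> n" using m by auto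
  then have "\<forall>x\<in>T. x \<otimes> g \<in> T"
    using g
  proof (induction rule: par_induct)
    case one
    have "x \<in> carrier G" if "x \<in> T" for x using that m by (auto simp: T_def)
    then show ?case by simp
  next
    case (t i)
    show ?case
    proof
      fix x assume "x \<in> T"
      then obtain h j where h: "h \<in> par 1 m" and j: "1 \<le> j" "j \<le> m + 1" and x: "x = h \<otimes> desc j m"
        by (auto simp: T_def)
      have c [simp]: "h \<in> carrier G" "desc j m \<in> carrier G" "desc (Suc j) m \<in> carrier G" "t i \<in> carrier G"
        using h j m t by auto
      consider "i + 1 < j" | "i + 1 = j" | "i = j" | "j < i" by linarith
      then show "x \<otimes> t i \<in> T"
      proof cases
        case 1
        then have "x \<otimes> t i = (h \<otimes> t i) \<otimes> desc j m"
          using t m by (simp add: x G.m_assoc desc_commute_below)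
        moreover have "h \<otimes> t i \<in> par 1 m"
          using h t 1 j by (intro par.m_closed t_in_par) auto
        ultimately show ?thesis using TI j by simp
      next
        case 2
        then have "x \<otimes> t i = h \<otimes> desc i m"
          using t m by (simp add: x G.m_assoc desc_snoc[of i m])
        then show ?thesis using TI[of h i] h t by simp
      next
        case 3
        then have "x \<otimes> t i = h \<otimes> desc (j + 1) m"
          using t m j by (simp add: x G.m_assoc desc_snoc[of j m] t_square)
        then show ?thesis using TI[of h "j + 1"] h t 3 by simp
      next
        case 4
        have [simp]: "t (i - 1) \<in> carrier G" using 4 t m j by simp
        have "x \<otimes> t i = (h \<otimes> t (i - 1)) \<otimes> desc j m"
          using 4 t m j by (simp add: x G.m_assoc desc_shift)
        moreover have "h \<otimes> t (i - 1) \<in> par 1 m"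
          using h t 4 j by (intro par.m_closed t_in_par) auto
        ultimately show ?thesis using TI j by simp
      qed
    qed
  next
    case (mult g h)
    then have "g \<in> carrier G" "h \<in> carrier G" using par_closed[of 1 "m + 1"] m by auto
    moreover have "x \<in> carrier G" if "x \<in> T" for x using that m by (auto simp: T_def)
    ultimately show ?case using mult by (metis G.m_assoc)
  qed
  moreover have "\<one> \<in> T"
    using TI[of \<one> "m + 1"] m par.one_closed by simp
  moreover have "g \<in> carrier G" using par_closed[of 1 "m + 1"] m g by simp
  ultimately have "g \<in> T" by (metis G.l_one)
  then show ?thesis unfolding T_def by blast
qed

lemma perm_par_fixes:
  assumes "1 \<le> a" "b \<le> n" "g \<in> par a b" "x < a \<or> b < x"
  shows "\<phi> g x = x"
  using assms(1-3)
proof (induction rule: par_induct)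
  case (t i)
  then show ?case using assms by (auto simp: perm_t transpose_def)
next
  case (mult g h)
  then show ?case using assms par_closed[of a b] by (simp add: perm_mult)
qed (simp add: perm_one)

text \<open>In the normal form \<open>h (desc j m)\<close>, the second factor sends \<open>j\<close> to \<open>m + 1\<close>, which \<open>h\<close> fixes. So an element
over the identity has \<open>j = m + 1\<close>, that is, it lies in the smaller parabolic subgroup already.\<close>

lemma perm_par_trivial: "m \<le> n \<Longrightarrow> g \<in> par 1 m \<Longrightarrow> \<phi> g = id \<Longrightarrow> g = \<one>"
proof (induction m arbitrary: g)
  case 0
  then show ?case by (simp add: par_def G.generate_empty)
next
  case (Suc m)
  then obtain h j where h: "h \<in> par 1 m" and j: "j \<in> {1..m + 1}" and g: "g = h \<otimes> desc j m"
    using par_normal_form[of m g] by auto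
  have [simp]: "h \<in> carrier G" "desc j m \<in> carrier G"
    using h j Suc.prems par_closed[of 1 m] by auto
  have "j = \<phi> g j" using Suc.prems by simp
  also have "\<phi> g = \<phi> h \<circ> \<phi> (desc j m)" by (simp add: g)
  also have "(\<phi> h \<circ> \<phi> (desc j m)) j = \<phi> h (m + 1)"
    using perm_desc[of j m] j Suc.prems by simp
  also have "\<dots> = m + 1"
    using perm_par_fixes[of 1 m h "m + 1"] h Suc.prems by simp
  finally have "g = h" by (simp add: g)
  then show ?case using Suc h by simp
qed

lemma inj_perm: "inj_on \<phi> (par 1 n)"
proof (rule inj_onI)
  fix g h assume gh: "g \<in> par 1 n" "h \<in> par 1 n" "\<phi> g = \<phi> h"
  have c: "g \<in> carrier G" "h \<in> carrier G" using gh par_closed[of 1 n] by auto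
  have "g \<otimes> inv h \<in> par 1 n"
    using subgroup_par[of 1 n] gh by (simp add: subgroup.m_closed subgroup.m_inv_closed)
  moreover have "\<phi> (g \<otimes> inv h) = id"
    using c gh hom_mult[of g "inv g"] hom_inv[of h] hom_inv[of g] by (simp del: hom_inv)
  ultimately have "g \<otimes> inv h = \<one>" by (intro perm_par_trivial) auto
  then show "g = h" using c by (metis G.inv_closed G.inv_equality G.inv_inv)
qed

lemma par_surj:
  assumes "1 \<le> a" "s permutes {a..n}"
  shows "\<exists>g\<in>par a n. \<phi> g = s"
  using assms(2)
proof (induction rule: permutes_adjacent_induct)
  case id
  show ?case using subgroup.one_closed[OF subgroup_par] assms(1) perm_one by blast
next
  case (adjacent i s)
  then obtain g where g: "g \<in> par a n" "\<phi> g = s" by blast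
  then have "\<phi> (t i \<otimes> g) = transpose i (i + 1) \<circ> s"
    using adjacent assms(1) par_closed[of a n] by (simp add: perm_mult perm_t)
  moreover have "t i \<otimes> g \<in> par a n"
    using adjacent assms(1) g subgroup.m_closed[OF subgroup_par] t_in_par by simp
  ultimately show ?case by blast
qed

end

section \<open>The generators of the pure subgroup\<close>

definition commute :: "('a, 'b) monoid_scheme \<Rightarrow> 'a \<Rightarrow> 'a \<Rightarrow> bool"
  where "commute G x y \<longleftrightarrow> x \<otimes>\<^bsub>G\<^esub> y = y \<otimes>\<^bsub>G\<^esub> x"

lemma commute_sym: "commute G x y \<Longrightarrow> commute G y x"
  by (simp add: commute_def)

context group
begin

lemma commute_mult:
  assumes "x \<in> carrier G" "y \<in> carrier G" "z \<in> carrier G" "commute G x y" "commute G x z"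
  shows "commute G x (y \<otimes> z)"
proof -
  have "x \<otimes> (y \<otimes> z) = (x \<otimes> y) \<otimes> z" using assms by (simp add: m_assoc)
  also have "\<dots> = y \<otimes> (x \<otimes> z)" using assms by (simp add: commute_def m_assoc)
  also have "\<dots> = y \<otimes> z \<otimes> x" using assms by (simp add: commute_def m_assoc)
  finally show ?thesis by (simp add: commute_def)
qed

lemma inv_cancel:
  assumes "x \<in> carrier G" "y \<in> carrier G"
  shows "x \<otimes> (inv x \<otimes> y) = y" "inv x \<otimes> (x \<otimes> y) = y"
  using assms by (simp_all flip: m_assoc)

lemma intertwine_inv:
  assumes "x \<in> carrier G" "y \<in> carrier G" "z \<in> carrier G" "x \<otimes> y = z \<otimes> x"
  shows "x \<otimes> inv y = inv z \<otimes> x"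
proof -
  have "x \<otimes> inv y = inv z \<otimes> (z \<otimes> x) \<otimes> inv y" using assms(1-3) by (simp add: inv_cancel)
  also have "\<dots> = inv z \<otimes> (x \<otimes> y) \<otimes> inv y" by (simp add: assms(4))
  also have "\<dots> = inv z \<otimes> x" using assms(1-3) by (simp add: m_assoc)
  finally show ?thesis .
qed

lemma commute_conj:
  assumes "g \<in> carrier G" "x \<in> carrier G" "y \<in> carrier G" "commute G x y"
  shows "commute G (g \<otimes> x \<otimes> inv g) (g \<otimes> y \<otimes> inv g)"
proof -
  have *: "g \<otimes> a \<otimes> inv g \<otimes> (g \<otimes> b \<otimes> inv g) = g \<otimes> (a \<otimes> b) \<otimes> inv g"
    if "a \<in> carrier G" "b \<in> carrier G" for a b
    using that assms(1) by (simp add: m_assoc inv_cancel)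
  show ?thesis unfolding commute_def *[OF assms(2,3)] *[OF assms(3,2)]
    using assms(4) by (simp add: commute_def)
qed

end

text \<open>The defining relations of the unrestricted virtual braid group, stated for generators of a group over
the symmetric group. The commutation relations of the \<open>lam i j\<close> defined below are consequences of these.\<close>

locale uvb_generators = coxeter_generators G n \<phi> \<rho>
  for G (structure) and n and \<phi> and \<rho> +
  fixes \<sigma> :: "nat \<Rightarrow> 'a"
  assumes n_ge: "3 \<le> n"
    and sigma_closed [simp]: "1 \<le> i \<Longrightarrow> i < n \<Longrightarrow> \<sigma> i \<in> carrier G"
    and sigma_commute: "1 \<le> i \<Longrightarrow> i + 1 < j \<Longrightarrow> j < n \<Longrightarrow> commute G (\<sigma> i) (\<sigma> j)"
    and sigma_rho_commute: "1 \<le> i \<Longrightarrow> 1 \<le> j \<Longrightarrow> i < n \<Longrightarrow> j < n \<Longrightarrow> \<bar>int i - int j\<bar> > 1 \<Longrightarrow>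
      commute G (\<sigma> i) (\<rho> j)"
    and sigma_braid: "1 \<le> i \<Longrightarrow> i + 1 < n \<Longrightarrow>
      \<sigma> i \<otimes> \<sigma> (i + 1) \<otimes> \<sigma> i = \<sigma> (i + 1) \<otimes> \<sigma> i \<otimes> \<sigma> (i + 1)"
    and sigma_rho_rho: "1 \<le> i \<Longrightarrow> i + 1 < n \<Longrightarrow>
      \<sigma> i \<otimes> \<rho> (i + 1) \<otimes> \<rho> i = \<rho> (i + 1) \<otimes> \<rho> i \<otimes> \<sigma> (i + 1)"
    and rho_sigma_sigma: "1 \<le> i \<Longrightarrow> i + 1 < n \<Longrightarrow>
      \<rho> i \<otimes> \<sigma> (i + 1) \<otimes> \<sigma> i = \<sigma> (i + 1) \<otimes> \<sigma> i \<otimes> \<rho> (i + 1)"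
    and rho_sigma_sigma': "1 \<le> i \<Longrightarrow> i + 1 < n \<Longrightarrow>
      \<rho> (i + 1) \<otimes> \<sigma> i \<otimes> \<sigma> (i + 1) = \<sigma> i \<otimes> \<sigma> (i + 1) \<otimes> \<rho> i"
    and perm_sigma: "1 \<le> i \<Longrightarrow> i < n \<Longrightarrow> \<phi> (\<sigma> i) = transpose i (i + 1)"
    and generates: "carrier G = generate G (\<sigma> ` {1..<n} \<union> \<rho> ` {1..<n})"
begin

abbreviation pairs :: "(nat \<times> nat) set"
  where "pairs \<equiv> {(i, j). i \<in> {1..n} \<and> j \<in> {1..n} \<and> i \<noteq> j}"

abbreviation R :: "'a set"
  where "R \<equiv> par 1 n"

lemma R_closed [simp]: "g \<in> R \<Longrightarrow> g \<in> carrier G"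
  using par_closed[of 1 n g] by simp

lemma R_mult: "g \<in> R \<Longrightarrow> h \<in> R \<Longrightarrow> g \<otimes> h \<in> R"
  and R_inv: "g \<in> R \<Longrightarrow> inv g \<in> R"
  using subgroup_par[of 1 n] by (simp_all add: subgroup.m_closed subgroup.m_inv_closed)

lemma rho_in_R: "1 \<le> i \<Longrightarrow> i < n \<Longrightarrow> \<rho> i \<in> R"
  by (rule t_in_par)

lemma perm_in_range: "g \<in> carrier G \<Longrightarrow> \<phi> g i \<in> {1..n} \<longleftrightarrow> i \<in> {1..n}"
  by (rule permutes_in_image[OF permutes_perm])

lemma perm_eq_iff: "g \<in> carrier G \<Longrightarrow> \<phi> g i = \<phi> g j \<longleftrightarrow> i = j"
  using permutes_inj[OF permutes_perm] by (auto dest: injD)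

lemma perm_pairs: "g \<in> carrier G \<Longrightarrow> (i, j) \<in> pairs \<Longrightarrow> (\<phi> g i, \<phi> g j) \<in> pairs"
  using perm_in_range[of g i] perm_in_range[of g j] perm_eq_iff[of g i j] by auto

lemma R_transitive:
  assumes "distinct xs" "distinct ys" "length xs = length ys" "set xs \<subseteq> {1..n}" "set ys \<subseteq> {1..n}"
  obtains g where "g \<in> R" "map (\<phi> g) xs = ys"
  using permutes_map_eq[OF assms] par_surj[of 1] by (metis order_refl)

definition base :: 'a
  where "base = \<sigma> 1 \<otimes> \<rho> 1"

definition lam :: "nat \<Rightarrow> nat \<Rightarrow> 'a"
  where "lam i j = (let g = SOME g. g \<in> R \<and> \<phi> g 1 = i \<and> \<phi> g 2 = j in g \<otimes> base \<otimes> inv g)"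

lemma base_closed [simp]: "base \<in> carrier G"
  using n_ge by (simp add: base_def)

lemma perm_base: "\<phi> base = id"
  using n_ge by (simp add: base_def perm_sigma perm_t)

text \<open>The permutation of \<open>g\<close> lives on \<open>{3..n}\<close>, so by \<open>inj_perm\<close> the element \<open>g\<close> is a word in
\<open>\<rho> 3, \<dots>, \<rho> (n - 1)\<close>, and each of these commutes with \<open>\<sigma> 1\<close> and \<open>\<rho> 1\<close>. It is this fact that makes
\<open>lam\<close> independent of choices.\<close>

lemma commute_R_base:
  assumes "g \<in> R" "\<phi> g 1 = 1" "\<phi> g 2 = 2"
  shows "commute G g base"
proof -
  have "\<phi> g permutes {3..n}"
  proof (rule permutes_superset)
    show "\<phi> g permutes {1..n}" by (rule permutes_perm) (use assms in simp)
    show "\<And>x. x \<in> {1..n} - {3..n} \<Longrightarrow> \<phi> g x = x"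
    proof -
      fix x assume "x \<in> {1..n} - {3..n}"
      then have "x = 1 \<or> x = 2" by auto
      then show "\<phi> g x = x" using assms by auto
    qed
  qed
  then obtain h where h: "h \<in> par 3 n" "\<phi> h = \<phi> g" using par_surj[of 3] by auto
  have "par 3 n \<subseteq> R" unfolding par_def by (intro G.mono_generate image_mono) auto
  then have "g = h" using inj_perm assms(1) h by (auto dest: inj_onD)
  have "1 \<le> (3::nat)" by simp
  then have "commute G base h"
    using order_refl[of n] h(1)
  proof (induction rule: par_induct)
    case one
    show ?case by (simp add: commute_def)
  next
    case (t i)
    have "commute G (\<rho> i) (\<sigma> 1)" "commute G (\<rho> i) (\<rho> 1)"
      using sigma_rho_commute[of 1 i] t_commute[of 1 i] t by (auto simp: commute_def)
    then show ?case
      unfolding base_def using t by (intro commute_sym[OF G.commute_mult]) auto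
  next
    case (mult g h)
    then show ?case using par_closed[of 3 n] by (intro G.commute_mult) auto
  qed
  then show ?thesis unfolding \<open>g = h\<close> by (rule commute_sym)
qed

lemma lam_eq:
  assumes "g \<in> R"
  shows "lam (\<phi> g 1) (\<phi> g 2) = g \<otimes> base \<otimes> inv g"
proof -
  define h where "h = (SOME h. h \<in> R \<and> \<phi> h 1 = \<phi> g 1 \<and> \<phi> h 2 = \<phi> g 2)"
  have "h \<in> R \<and> \<phi> h 1 = \<phi> g 1 \<and> \<phi> h 2 = \<phi> g 2"
    unfolding h_def by (rule someI[of _ g]) (use assms in simp)
  then have h: "h \<in> R" "\<phi> h 1 = \<phi> g 1" "\<phi> h 2 = \<phi> g 2" by auto
  have "\<phi> g x = \<phi> h (\<phi> (inv h \<otimes> g) x)" for x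
    using perm_mult[of h "inv h \<otimes> g"] h assms by (simp add: G.inv_cancel del: hom_mult)
  then have "\<phi> (inv h \<otimes> g) 1 = 1" "\<phi> (inv h \<otimes> g) 2 = 2"
    using h perm_eq_iff[of h] by (metis R_closed)+
  then have "commute G (inv h \<otimes> g) base"
    using h assms by (intro commute_R_base R_mult R_inv)
  then have "h \<otimes> (inv h \<otimes> g \<otimes> base) \<otimes> inv g = h \<otimes> (base \<otimes> (inv h \<otimes> g)) \<otimes> inv g"
    by (simp add: commute_def)
  moreover have "h \<otimes> (inv h \<otimes> g \<otimes> base) \<otimes> inv g = g \<otimes> base \<otimes> inv g"
    using h assms by (simp add: G.m_assoc[symmetric])
  moreover have "h \<otimes> (base \<otimes> (inv h \<otimes> g)) \<otimes> inv g = h \<otimes> base \<otimes> inv h"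
    using h assms by (simp add: G.m_assoc)
  ultimately show ?thesis unfolding lam_def Let_def h_def[symmetric] by simp
qed

lemma lam_cases:
  assumes "(i, j) \<in> pairs"
  obtains g where "g \<in> R" "\<phi> g 1 = i" "\<phi> g 2 = j" "lam i j = g \<otimes> base \<otimes> inv g"
proof -
  obtain g where g: "g \<in> R" "map (\<phi> g) [1, 2] = [i, j]"
    using R_transitive[of "[1, 2]" "[i, j]"] assms n_ge by auto
  then show ?thesis using that[of g] lam_eq[of g] by auto
qed

lemma lam_closed [simp]: "(i, j) \<in> pairs \<Longrightarrow> lam i j \<in> carrier G"
  by (rule lam_cases) auto

lemma perm_lam: "(i, j) \<in> pairs \<Longrightarrow> \<phi> (lam i j) = id"
proof (erule lam_cases)
  fix g assume g: "g \<in> R" "lam i j = g \<otimes> base \<otimes> inv g"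
  have "\<phi> (lam i j) = \<phi> g \<circ> inv\<^bsub>sym_group n\<^esub> (\<phi> g)"
    using g by (simp add: perm_base)
  also have "\<dots> = id"
    using H.r_inv[of "\<phi> g"] g(1) by simp
  finally show "\<phi> (lam i j) = id" .
qed

lemma R_conj_lam:
  assumes "g \<in> R" "(i, j) \<in> pairs"
  shows "g \<otimes> lam i j \<otimes> inv g = lam (\<phi> g i) (\<phi> g j)"
proof -
  obtain h where h: "h \<in> R" "\<phi> h 1 = i" "\<phi> h 2 = j" "lam i j = h \<otimes> base \<otimes> inv h"
    using lam_cases[OF assms(2)] .
  have "lam (\<phi> (g \<otimes> h) 1) (\<phi> (g \<otimes> h) 2) = g \<otimes> h \<otimes> base \<otimes> inv (g \<otimes> h)"
    using assms h by (intro lam_eq R_mult)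
  then show ?thesis
    using assms h by (simp add: G.m_assoc G.inv_mult_group)
qed

lemma R_lam:
  assumes g: "g \<in> R" and ij: "(i, j) \<in> pairs"
  shows "g \<otimes> lam i j = lam (\<phi> g i) (\<phi> g j) \<otimes> g"
  by (rule G.conj_eq_iff[THEN iffD1, OF R_closed[OF g] lam_closed[OF ij]
        lam_closed[OF perm_pairs[OF R_closed[OF g] ij]] R_conj_lam[OF g ij]])

text \<open>The mixed relation and the braid relation of the \<open>\<rho>\<close>'s say that \<open>\<rho> (i + 1) \<rho> i\<close> conjugates
\<open>\<sigma> (i + 1) \<rho> (i + 1)\<close> to \<open>\<sigma> i \<rho> i\<close>; its permutation sends \<open>i + 1, i + 2\<close> to \<open>i, i + 1\<close>.\<close>

lemma sigma_eq: "1 \<le> i \<Longrightarrow> i < n \<Longrightarrow> \<sigma> i = lam i (i + 1) \<otimes> \<rho> i"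
proof -
  have "1 \<le> i \<Longrightarrow> i < n \<Longrightarrow> lam i (i + 1) = \<sigma> i \<otimes> \<rho> i"
  proof (induction i rule: nat_induct_at_least[of 1])
    case base
    show ?case
      using lam_eq[of \<one>] subgroup.one_closed[OF subgroup_par[of 1 n]]
      n_ge by (simp add: base_def perm_one numeral_2_eq_2)
  next
    case (Suc i)
    let ?c = "\<rho> (i + 1) \<otimes> \<rho> i"
    have i: "1 \<le> i" "i + 1 < n" using Suc by auto
    have c: "?c \<in> R" using i by (intro R_mult rho_in_R) auto
    have "?c \<otimes> lam (i + 1) (i + 2) = lam i (i + 1) \<otimes> ?c"
      using R_lam[OF c, of "i + 1" "i + 2"] i by (simp add: perm_t)
    also have "\<dots> = \<sigma> i \<otimes> (\<rho> i \<otimes> \<rho> (i + 1) \<otimes> \<rho> i)"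
      using Suc i by (simp add: G.m_assoc)
    also have "\<dots> = (\<sigma> i \<otimes> \<rho> (i + 1) \<otimes> \<rho> i) \<otimes> \<rho> (i + 1)"
      using t_braid[of i] i by (simp add: G.m_assoc)
    also have "\<dots> = ?c \<otimes> (\<sigma> (i + 1) \<otimes> \<rho> (i + 1))"
      using sigma_rho_rho[of i] i by (simp add: G.m_assoc)
    finally show ?case
      using i by simp
  qed
  then show "1 \<le> i \<Longrightarrow> i < n \<Longrightarrow> \<sigma> i = lam i (i + 1) \<otimes> \<rho> i"
    by (simp add: G.m_assoc t_square)
qed

lemma rho_lam:
  assumes "1 \<le> k" "k < n" "(i, j) \<in> pairs" "x \<in> carrier G"
  shows "\<rho> k \<otimes> (lam i j \<otimes> x) =
    lam (transpose k (k + 1) i) (transpose k (k + 1) j) \<otimes> (\<rho> k \<otimes> x)"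
proof -
  have "(transpose k (k + 1) i, transpose k (k + 1) j) \<in> pairs"
    using assms by (auto simp: transpose_def)
  then show ?thesis
    using R_lam[OF rho_in_R[OF assms(1,2)] assms(3)] assms
    by (simp add: perm_t flip: G.m_assoc)
qed

text \<open>Substituting \<open>\<sigma> i = lam i (i + 1) \<rho> i\<close> and moving all \<open>\<rho>\<close>'s to the right turns the relation
\<open>\<rho> 2 \<sigma> 1 \<sigma> 2 = \<sigma> 1 \<sigma> 2 \<rho> 1\<close> into the first statement, \<open>\<rho> 1 \<sigma> 2 \<sigma> 1 = \<sigma> 2 \<sigma> 1 \<rho> 2\<close> into the second, and the braid
relation into \<open>lam 1 2 lam 1 3 lam 2 3 = lam 2 3 lam 1 3 lam 1 2\<close>. By the first two, \<open>lam 1 3\<close> can be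
cancelled from the latter. The last statement is the commutation of generators with distant indices.\<close>

lemma
  shows commute_lam_12_13: "commute G (lam 1 2) (lam 1 3)"
    and commute_lam_13_23: "commute G (lam 1 3) (lam 2 3)"
    and commute_lam_12_23: "commute G (lam 1 2) (lam 2 3)"
    and commute_lam_12_34: "4 \<le> n \<Longrightarrow> commute G (lam 1 2) (lam 3 4)"
proof -
  have p: "(1, 2) \<in> pairs" "(2, 3) \<in> pairs" "(1, 3) \<in> pairs" "1 < n" "2 < n" using n_ge by auto
  have c: "lam 1 2 \<in> carrier G" "lam 2 3 \<in> carrier G" "lam 1 3 \<in> carrier G"
    "\<rho> 1 \<in> carrier G" "\<rho> 2 \<in> carrier G"
    using p by (auto simp del: One_nat_def)
  let ?r = "\<rho> 1 \<otimes> (\<rho> 2 \<otimes> \<rho> 1)"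
  have r: "\<rho> 2 \<otimes> (\<rho> 1 \<otimes> \<rho> 2) = ?r"
    using t_braid[of 1] c p by (simp add: G.m_assoc del: One_nat_def)
  have s: "\<sigma> 1 = lam 1 2 \<otimes> \<rho> 1" "\<sigma> 2 = lam 2 3 \<otimes> \<rho> 2"
    using sigma_eq[of 1] sigma_eq[of 2] p by (simp_all del: One_nat_def)
  have rl: "\<rho> 1 \<otimes> (lam 2 3 \<otimes> x) = lam 1 3 \<otimes> (\<rho> 1 \<otimes> x)" "\<rho> 1 \<otimes> (lam 1 3 \<otimes> x) = lam 2 3 \<otimes> (\<rho> 1 \<otimes> x)"
    "\<rho> 2 \<otimes> (lam 1 2 \<otimes> x) = lam 1 3 \<otimes> (\<rho> 2 \<otimes> x)" "\<rho> 2 \<otimes> (lam 1 3 \<otimes> x) = lam 1 2 \<otimes> (\<rho> 2 \<otimes> x)"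
    if "x \<in> carrier G" for x
    using rho_lam[of 1 2 3 x] rho_lam[of 1 1 3 x] rho_lam[of 2 1 2 x] rho_lam[of 2 1 3 x] that p
    by (simp_all add: transpose_def del: One_nat_def)
  note push = rl G.m_assoc r s c
  have "\<rho> 2 \<otimes> \<sigma> 1 \<otimes> \<sigma> 2 = \<sigma> 1 \<otimes> \<sigma> 2 \<otimes> \<rho> 1"
    using rho_sigma_sigma'[of 1] p by (simp del: One_nat_def)
  then have "lam 1 3 \<otimes> (lam 1 2 \<otimes> ?r) = lam 1 2 \<otimes> (lam 1 3 \<otimes> ?r)"
    by (simp add: push del: One_nat_def)
  then have "(lam 1 3 \<otimes> lam 1 2) \<otimes> ?r = (lam 1 2 \<otimes> lam 1 3) \<otimes> ?r"
    using c by (simp add: G.m_assoc del: One_nat_def G.right_cancel)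
  then show 12: "commute G (lam 1 2) (lam 1 3)"
    using c by (simp add: commute_def del: One_nat_def)
  have "\<rho> 1 \<otimes> \<sigma> 2 \<otimes> \<sigma> 1 = \<sigma> 2 \<otimes> \<sigma> 1 \<otimes> \<rho> 2"
    using rho_sigma_sigma[of 1] p by (simp del: One_nat_def)
  then have "lam 1 3 \<otimes> (lam 2 3 \<otimes> ?r) = lam 2 3 \<otimes> (lam 1 3 \<otimes> ?r)"
    by (simp add: push del: One_nat_def)
  then have "(lam 1 3 \<otimes> lam 2 3) \<otimes> ?r = (lam 2 3 \<otimes> lam 1 3) \<otimes> ?r"
    using c by (simp add: G.m_assoc del: One_nat_def G.right_cancel)
  then show 23: "commute G (lam 1 3) (lam 2 3)"
    using c by (simp add: commute_def del: One_nat_def)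
  have "\<sigma> 1 \<otimes> \<sigma> 2 \<otimes> \<sigma> 1 = \<sigma> 2 \<otimes> \<sigma> 1 \<otimes> \<sigma> 2"
    using sigma_braid[of 1] p by (simp del: One_nat_def)
  then have "lam 1 2 \<otimes> (lam 1 3 \<otimes> (lam 2 3 \<otimes> ?r)) = lam 2 3 \<otimes> (lam 1 3 \<otimes> (lam 1 2 \<otimes> ?r))"
    by (simp add: push del: One_nat_def)
  then have "((lam 1 2 \<otimes> lam 1 3) \<otimes> lam 2 3) \<otimes> ?r = ((lam 2 3 \<otimes> lam 1 3) \<otimes> lam 1 2) \<otimes> ?r"
    using c by (simp add: G.m_assoc del: One_nat_def G.right_cancel)
  then have "(lam 1 2 \<otimes> lam 1 3) \<otimes> lam 2 3 = (lam 2 3 \<otimes> lam 1 3) \<otimes> lam 1 2"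
    using c by (simp del: One_nat_def)
  then have "(lam 1 3 \<otimes> lam 1 2) \<otimes> lam 2 3 = (lam 1 3 \<otimes> lam 2 3) \<otimes> lam 1 2"
    using 12 23 by (simp add: commute_def del: One_nat_def)
  then show "commute G (lam 1 2) (lam 2 3)"
    using c by (simp add: commute_def G.m_assoc del: One_nat_def)
  assume n: "4 \<le> n"
  have "lam 1 2 = base" "lam 3 4 = \<sigma> 3 \<otimes> \<rho> 3"
    using sigma_eq[of 1] sigma_eq[of 3] n
    by (simp_all add: base_def G.m_assoc t_square del: One_nat_def)
  moreover have "commute G (\<sigma> 1) (\<sigma> 3)" "commute G (\<sigma> 1) (\<rho> 3)" "commute G (\<rho> 1) (\<sigma> 3)" "commute G (\<rho> 1) (\<rho> 3)"
    using sigma_commute[of 1 3] sigma_rho_commute[of 1 3] sigma_rho_commute[of 3 1] t_commute[of 1 3] n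
    by (auto simp: commute_def)
  ultimately show "commute G (lam 1 2) (lam 3 4)"
    using n by (auto simp: base_def intro!: G.commute_mult commute_sym[OF G.commute_mult] intro: commute_sym)
qed

text \<open>Conjugation by the \<open>\<rho>\<close>'s moves the indices arbitrarily, so the statement reduces to representatives of
the possible overlaps of \<open>{i, j}\<close> and \<open>{k, l}\<close>: none, or one common element in one of the positions
treated by the preceding lemma.\<close>

lemma commute_lam:
  assumes "(i, j) \<in> pairs" "(k, l) \<in> pairs" "{i, j} \<noteq> {k, l}"
  shows "commute G (lam i j) (lam k l)"
proof -
  have move: "commute G (lam (\<phi> g a) (\<phi> g b)) (lam (\<phi> g c) (\<phi> g d))"
    if "g \<in> R" "(a, b) \<in> pairs" "(c, d) \<in> pairs" "commute G (lam a b) (lam c d)" for g a b c d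
    using that G.commute_conj[of g "lam a b" "lam c d"] R_conj_lam by simp
  have three: "commute G (lam x y) (lam x z)" "commute G (lam x z) (lam y z)" "commute G (lam x y) (lam y z)"
    if xyz: "distinct [x, y, z]" "{x, y, z} \<subseteq> {1..n}" for x y z
  proof -
    obtain g where g: "g \<in> R" "map (\<phi> g) [1, 2, 3] = [x, y, z]"
      by (rule R_transitive[of "[1, 2, 3]" "[x, y, z]"]) (use xyz n_ge in auto)
    then have "\<phi> g 1 = x" "\<phi> g 2 = y" "\<phi> g 3 = z" by auto
    then show "commute G (lam x y) (lam x z)" "commute G (lam x z) (lam y z)" "commute G (lam x y) (lam y z)"
      using move[OF g(1), of 1 2 1 3] move[OF g(1), of 1 3 2 3] move[OF g(1), of 1 2 2 3]
        commute_lam_12_13 commute_lam_13_23 commute_lam_12_23 n_ge by auto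
  qed
  consider "distinct [i, j, k, l]" | "i = k" "j \<noteq> l" | "j = l" "i \<noteq> k" | "j = k" "i \<noteq> l" | "i = l" "j \<noteq> k"
    using assms by auto
  then show ?thesis
  proof cases
    case 1
    have "card (set [i, j, k, l]) \<le> card {1..n}" using assms by (intro card_mono) auto
    then have n: "4 \<le> n" using 1 by simp
    obtain g where g: "g \<in> R" "map (\<phi> g) [1, 2, 3, 4] = [i, j, k, l]"
      by (rule R_transitive[of "[1, 2, 3, 4]" "[i, j, k, l]"]) (use 1 assms n in auto)
    then have "\<phi> g 1 = i" "\<phi> g 2 = j" "\<phi> g 3 = k" "\<phi> g 4 = l" by auto
    then show ?thesis using move[OF g(1), of 1 2 3 4] commute_lam_12_34 n by auto
  next
    case 2 then show ?thesis using three(1)[of i j l] assms by auto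
  next
    case 3 then show ?thesis using three(2)[of i k j] assms by auto
  next
    case 4 then show ?thesis using three(3)[of i j l] assms by auto
  next
    case 5 then show ?thesis using three(3)[of k i j] assms by (auto intro: commute_sym)
  qed
qed

text \<open>Pure elements are handled through words in the symbols \<open>(i, j)\<close> and their inverses.\<close>

abbreviation lamp :: "nat \<times> nat \<Rightarrow> 'a"
  where "lamp \<equiv> case_prod lam"

abbreviation ev :: "(nat \<times> nat) word \<Rightarrow> 'a"
  where "ev \<equiv> word_eval G lamp"

lemma lamp_funcset: "lamp \<in> pairs \<rightarrow> carrier G"
  by auto

lemmas ev_closed = G.word_eval_closed[OF lamp_funcset]
lemmas ev_append = G.word_eval_append[OF lamp_funcset]

lemma ev_Nil: "ev [] = \<one>"
  by (simp add: word_eval_def)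

lemma ev_Cons: "ev ((p, b) # w) = (if b then lamp p else inv (lamp p)) \<otimes> ev w"
  by (simp add: word_eval_def)

lemma perm_ev: "w \<in> words pairs \<Longrightarrow> \<phi> (ev w) = id"
proof (induction w)
  case (Cons x w)
  obtain i j b where x: "x = ((i, j), b)" by (metis prod.exhaust)
  have "inv\<^bsub>sym_group n\<^esub> id = id"
    using H.inv_one by simp
  then have "\<phi> (inv (lam i j)) = id" "\<phi> (lam i j) = id"
    using perm_lam[of i j] Cons.prems x by auto
  then show ?case
    using Cons ev_closed[of w]
    by (simp add: x ev_Cons)
qed (simp add: ev_Nil perm_one)

lemma R_ev:
  assumes "g \<in> R" "w \<in> words pairs"
  shows "\<exists>w'\<in>words pairs. g \<otimes> ev w = ev w' \<otimes> g"
  using assms(2)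
proof (induction w)
  case Nil
  show ?case using assms(1) by (intro bexI[of _ "[]"]) (auto simp: ev_Nil)
next
  case (Cons x w)
  obtain i j b where x: "x = ((i, j), b)" by (metis prod.exhaust)
  have ij: "(i, j) \<in> pairs" and w: "w \<in> words pairs" using Cons.prems x by auto
  obtain w' where w': "w' \<in> words pairs" "g \<otimes> ev w = ev w' \<otimes> g" using Cons.IH[OF w] by blast
  define q where "q = (\<phi> g i, \<phi> g j)"
  have q: "q \<in> pairs"
    unfolding q_def using ij assms(1) by (intro perm_pairs) auto
  have "g \<otimes> lam i j = lamp q \<otimes> g" using R_lam[OF assms(1) ij] by (simp add: q_def)
  moreover from this have "g \<otimes> inv (lam i j) = inv (lamp q) \<otimes> g"
    using q ij assms(1) funcset_mem[OF lamp_funcset q] by (intro G.intertwine_inv) auto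
  ultimately have "g \<otimes> (if b then lam i j else inv (lam i j)) = (if b then lamp q else inv (lamp q)) \<otimes> g"
    by simp
  then have "g \<otimes> ev (x # w) = ev ((q, b) # w') \<otimes> g"
    using w' ij q assms(1) ev_closed[OF w] ev_closed[OF w'(1)] funcset_mem[OF lamp_funcset q]
    by (cases b) (simp_all add: x ev_Cons G.m_assoc[symmetric], simp_all add: G.m_assoc)
  then show ?case using q w' by (intro bexI[of _ "(q, b) # w'"]) auto
qed

text \<open>The products of a word in the \<open>lam i j\<close> and an element of \<open>R\<close> are closed under left multiplication by all
generators, by \<open>R_ev\<close> and \<open>sigma_eq\<close>.\<close>

lemma ev_R_decomposition:
  assumes "g \<in> carrier G"
  obtains w h where "w \<in> words pairs" "h \<in> R" "g = ev w \<otimes> h"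
proof -
  define T where "T = {ev w \<otimes> h | w h. w \<in> words pairs \<and> h \<in> R}"
  have TI: "ev w \<otimes> h \<in> T" if "w \<in> words pairs" "h \<in> R" for w h
    using that by (auto simp: T_def)
  have TG: "x \<in> carrier G" if "x \<in> T" for x
    using that ev_closed by (auto simp: T_def)
  have rhoT: "\<rho> i \<otimes> x \<in> T" if i: "1 \<le> i" "i < n" and "x \<in> T" for i x
  proof -
    obtain w h where w: "w \<in> words pairs" "h \<in> R" "x = ev w \<otimes> h" using \<open>x \<in> T\<close> by (auto simp: T_def)
    obtain w' where w': "w' \<in> words pairs" "\<rho> i \<otimes> ev w = ev w' \<otimes> \<rho> i"
      using R_ev[OF rho_in_R[OF i] w(1)] by blast
    have "\<rho> i \<otimes> x = ev w' \<otimes> (\<rho> i \<otimes> h)"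
      using w w' i ev_closed by (simp flip: G.m_assoc)
    then show ?thesis using TI w' w i R_mult rho_in_R by simp
  qed
  have lamT: "lamp p \<otimes> x \<in> T" "inv (lamp p) \<otimes> x \<in> T" if p: "p \<in> pairs" and "x \<in> T" for p x
  proof -
    obtain w h where w: "w \<in> words pairs" "h \<in> R" "x = ev w \<otimes> h" using \<open>x \<in> T\<close> by (auto simp: T_def)
    have "(if b then lamp p else inv (lamp p)) \<otimes> x = ev ((p, b) # w) \<otimes> h" for b
      using w p ev_closed funcset_mem[OF lamp_funcset p] by (simp add: ev_Cons G.m_assoc)
    moreover have "ev ((p, b) # w) \<otimes> h \<in> T" for b using w p by (intro TI) auto
    ultimately have "(if b then lamp p else inv (lamp p)) \<otimes> x \<in> T" for b by metis
    from this[of True] this[of False] show "lamp p \<otimes> x \<in> T" "inv (lamp p) \<otimes> x \<in> T" by simp_all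
  qed
  have sigma: "\<sigma> i \<otimes> x = lamp (i, i + 1) \<otimes> (\<rho> i \<otimes> x)" "inv (\<sigma> i) \<otimes> x = \<rho> i \<otimes> (inv (lamp (i, i + 1)) \<otimes> x)"
    if "1 \<le> i" "i < n" "x \<in> carrier G" for i x
    using that by (simp_all add: sigma_eq G.inv_mult_group inv_t G.m_assoc)
  have "g \<in> generate G (\<sigma> ` {1..<n} \<union> \<rho> ` {1..<n})" using assms generates by simp
  then have "\<forall>x\<in>T. g \<otimes> x \<in> T"
  proof (induction rule: generate.induct)
    case one
    then show ?case using TG by simp
  next
    case (incl h)
    then show ?case using TG rhoT lamT by (auto simp: sigma)
  next
    case (inv h)
    then show ?case using TG rhoT lamT by (auto simp: sigma inv_t)
  next
    case (eng g h)
    have "g \<in> carrier G" "h \<in> carrier G" using eng(1,2) generates by auto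
    then show ?case using eng TG by (metis G.m_assoc)
  qed
  moreover have "\<one> \<in> T"
    using TI[of "[]" \<one>] subgroup.one_closed[OF subgroup_par[of 1 n]] by (simp add: ev_Nil)
  ultimately have "g \<in> T" using assms by (metis G.r_one)
  then show ?thesis using that by (auto simp: T_def)
qed

lemma kernel_eq_ev:
  assumes "g \<in> carrier G" "\<phi> g = id"
  obtains w where "w \<in> words pairs" "g = ev w"
proof -
  obtain w h where w: "w \<in> words pairs" "h \<in> R" "g = ev w \<otimes> h"
    using ev_R_decomposition[OF assms(1)] .
  have "\<phi> h = \<phi> g"
    using w perm_mult[OF ev_closed[OF w(1)] R_closed[OF w(2)]] perm_ev[OF w(1)] by simp
  then have "h = \<one>" using perm_par_trivial[of n h] w assms by simp
  then show ?thesis using that w ev_closed[OF w(1)] by simp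
qed

end

section \<open>An action by shears\<close>

text \<open>The point \<open>(a, b, x, y)\<close> is the vector \<open>(x, y)\<close> of the plane attached to the block \<open>(a, b)\<close>. The shear
\<open>shear i j\<close> is unipotent upper triangular on the block \<open>(i, j)\<close> and lower triangular on \<open>(j, i)\<close>. On the
block \<open>(i, j)\<close> alone, \<open>shear i j\<close> and \<open>shear j i\<close> are thus the two matrices of Sanov, which generate a
free group.\<close>

type_synonym point = "nat \<times> nat \<times> int \<times> int"

fun shear :: "nat \<Rightarrow> nat \<Rightarrow> point \<Rightarrow> point" where
  "shear i j (a, b, x, y) =
    (if (a, b) = (i, j) then (a, b, x + 2 * y, y)
     else if (a, b) = (j, i) then (a, b, x, y + 2 * x)
     else (a, b, x, y))"

fun perm_point :: "(nat \<Rightarrow> nat) \<Rightarrow> point \<Rightarrow> point" where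
  "perm_point s (a, b, x, y) = (s a, s b, x, y)"

definition reduced :: "'a word \<Rightarrow> bool"
  where "reduced w \<longleftrightarrow> (\<nexists>u v p b. w = u @ (p, b) # (p, \<not> b) # v)"

lemma reduced_tl: "reduced (x # w) \<Longrightarrow> reduced w"
  unfolding reduced_def by (metis append_Cons)

lemma reduced_hd:
  assumes "reduced ((p, b) # (q, c) # w)"
  shows "(p, b) \<noteq> (q, \<not> c)"
proof
  assume "(p, b) = (q, \<not> c)"
  then have "(p, b) # (q, c) # w = [] @ (p, b) # (p, \<not> b) # w" by simp
  then show False using assms unfolding reduced_def by metis
qed

text \<open>The primed matrix \<open>N\<close> commutes with the matrix \<open>M\<close> with rows \<open>(a, b)\<close> and \<open>(c, d)\<close>, with its conjugate by
the upper shear with entry \<open>t\<close>, and with its conjugate by the lower shear with entry \<open>t\<close>; the three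
groups of equations express this entrywise. A matrix commutes with a non-scalar \<open>N\<close> only if its
trace-free part is proportional to that of \<open>N\<close>, and the trace-free parts of a non-scalar \<open>M\<close> and of its
two conjugates do not lie on one line.\<close>

lemma commuting_shears_scalar:
  fixes a b c d a' b' c' d' t :: int
  assumes t: "t \<noteq> 0"
    and e1: "b * c' = b' * c" "(a - d) * b' = (a' - d') * b" "(a - d) * c' = (a' - d') * c"
    and e2: "(b - t * (a - d) - t * t * c) * c' = b' * c"
      "(a - d + 2 * t * c) * b' = (a' - d') * (b - t * (a - d) - t * t * c)"
      "(a - d + 2 * t * c) * c' = (a' - d') * c"
    and e3: "b * c' = b' * (c + t * (a - d) - t * t * b)"
      "(a - d - 2 * t * b) * b' = (a' - d') * b"
      "(a - d - 2 * t * b) * c' = (a' - d') * (c + t * (a - d) - t * t * b)"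
  shows "(b = 0 \<and> c = 0 \<and> a = d) \<or> (b' = 0 \<and> c' = 0 \<and> a' = d')"
proof -
  define h h' where "h = a - d" and "h' = a' - d'"
  note e = e1 e2 e3
  note e = e[folded h_def h'_def]
  have cc: "c * c' = 0" using e(3,6) t by (simp add: algebra_simps)
  have bb: "b * b' = 0" using e(2,8) t by (simp add: algebra_simps)
  have hc: "h * c' = 0"
  proof -
    have "t * (h * c') = - (t * t * (c * c'))" using e(1,4) by (simp add: algebra_simps)
    then show ?thesis using cc t by simp
  qed
  have hb: "h * b' = 0"
  proof -
    have "t * (h * b') = t * t * (b * b')" using e(1,7) by (simp add: algebra_simps)
    then show ?thesis using bb t by simp
  qed
  have hc': "h' * c = 0" and hb': "h' * b = 0" using e(2,3) hb hc by simp_all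
  have "t * (2 * (c * b') + h * h') =
      ((h + 2 * t * c) * b' - h' * (b - t * h - t * t * c)) - h * b' + h' * b - t * t * (h' * c)"
    by (simp add: algebra_simps)
  also have "\<dots> = 0"
    by (simp add: e(5) hb hc' hb')
  finally have hh: "2 * (c * b') + h * h' = 0" using t by simp
  show ?thesis
  proof (cases "c' = 0 \<and> b' = 0")
    case True
    then show ?thesis using hh hc' hb' unfolding h_def h'_def by auto
  next
    case False
    then show ?thesis using cc bb hc hb e(1) unfolding h_def by auto
  qed
qed

locale uvb_action = uvb_generators +
  fixes th :: "'a \<Rightarrow> point \<Rightarrow> point"
  assumes th_mult: "g \<in> carrier G \<Longrightarrow> h \<in> carrier G \<Longrightarrow> th (g \<otimes> h) z = th g (th h z)"
    and th_one: "th \<one> z = z"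
    and th_rho: "1 \<le> i \<Longrightarrow> i < n \<Longrightarrow> th (\<rho> i) z = perm_point (transpose i (i + 1)) z"
    and th_sigma: "1 \<le> i \<Longrightarrow> i < n \<Longrightarrow>
      th (\<sigma> i) z = shear i (i + 1) (perm_point (transpose i (i + 1)) z)"
begin

lemma th_inv: "g \<in> carrier G \<Longrightarrow> th (inv g) (th g z) = z" "g \<in> carrier G \<Longrightarrow> th g (th (inv g) z) = z"
  by (simp_all flip: th_mult add: th_one)

lemma th_inj: "g \<in> carrier G \<Longrightarrow> th g z = th g z' \<longleftrightarrow> z = z'"
  using th_inv(1) by metis

lemma th_R: "g \<in> R \<Longrightarrow> th g (a, b, x, y) = (\<phi> g a, \<phi> g b, x, y)"
proof -
  assume g: "g \<in> R"
  have "1 \<le> (1::nat)" by simp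
  then have "\<forall>a b. th g (a, b, x, y) = (\<phi> g a, \<phi> g b, x, y)"
    using order_refl[of n] g
  proof (induction rule: par_induct)
    case one
    then show ?case by (simp add: th_one perm_one)
  next
    case (t i)
    then show ?case by (simp add: th_rho perm_t)
  next
    case (mult g h)
    then show ?case by (simp add: th_mult)
  qed
  then show ?thesis by blast
qed

lemma th_base: "th base z = shear 1 2 z"
proof -
  have n: "1 < n" using n_ge by simp
  have "perm_point (transpose 1 2) (perm_point (transpose 1 2) z) = z" by (cases z) simp
  then show ?thesis
    using n unfolding base_def
    by (simp add: th_mult th_sigma th_rho numeral_2_eq_2)
qed

text \<open>Conjugating a shear by an element that only permutes blocks gives the shear of the permuted block.\<close>

lemma th_lam: "(i, j) \<in> pairs \<Longrightarrow> th (lam i j) z = shear i j z"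
proof (erule lam_cases)
  fix g assume g: "g \<in> R" "\<phi> g 1 = i" "\<phi> g 2 = j" "lam i j = g \<otimes> base \<otimes> inv g"
  obtain a b x y where z: "z = (a, b, x, y)" by (metis prod.exhaust)
  define a' b' where "a' = \<phi> (inv g) a" and "b' = \<phi> (inv g) b"
  have gi: "th (inv g) z = (a', b', x, y)"
    using th_R[OF R_inv[OF g(1)]] by (simp add: z a'_def b'_def)
  have "(\<phi> g a', \<phi> g b', x, y) = (a, b, x, y)"
    using th_R[OF g(1), of a' b' x y] th_inv(2)[of g z] gi g(1) z by simp
  then have ab: "a = \<phi> g a'" "b = \<phi> g b'" by simp_all
  have "th (lam i j) z = th g (shear 1 2 (a', b', x, y))"
    using g gi by (simp add: th_mult th_base)
  also have "\<dots> = shear i j (a, b, x, y)"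
    using perm_eq_iff[of g] g(1) by (auto simp: th_R g(2,3)[symmetric] ab)
  finally show ?thesis by (simp add: z)
qed

lemma th_inv_lam:
  assumes "(i, j) \<in> pairs"
  shows "th (inv (lam i j)) (a, b, x, y) =
    (if (a, b) = (i, j) then (a, b, x - 2 * y, y)
     else if (a, b) = (j, i) then (a, b, x, y - 2 * x) else (a, b, x, y))" (is "_ = ?z")
proof -
  have "th (lam i j) ?z = (a, b, x, y)"
    by (simp add: th_lam[OF assms])
  then show ?thesis using th_inv(1)[of "lam i j" ?z] lam_closed[OF assms] by simp
qed

lemma th_letter_fixes:
  assumes "(i, j) \<in> pairs" "{a, b} \<noteq> {i, j}"
  shows "th (if c then lam i j else inv (lam i j)) (a, b, x, y) = (a, b, x, y)"
  using assms th_lam[OF assms(1)] th_inv_lam[OF assms(1)] by auto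

lemma th_ev_linear:
  assumes "w \<in> words pairs"
  shows "\<exists>\<alpha> \<beta> \<gamma> \<delta>. \<forall>x y. th (ev w) (a, b, x, y) = (a, b, \<alpha> * x + \<beta> * y, \<gamma> * x + \<delta> * y)"
  using assms
proof (induction w)
  case Nil
  show ?case by (rule exI[of _ 1], rule exI[of _ 0], rule exI[of _ 0], rule exI[of _ 1]) (simp add: ev_Nil th_one)
next
  case (Cons l w)
  obtain i j c where l: "l = ((i, j), c)" by (metis prod.exhaust)
  have ij: "(i, j) \<in> pairs" and w: "w \<in> words pairs" using Cons.prems l by auto
  obtain \<alpha> \<beta> \<gamma> \<delta> where IH: "\<And>x y. th (ev w) (a, b, x, y) = (a, b, \<alpha> * x + \<beta> * y, \<gamma> * x + \<delta> * y)"
    using Cons.IH[OF w] by metis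
  define s :: int where "s = (if c then 2 else - 2)"
  have letter: "th (if c then lam i j else inv (lam i j)) (a, b, x, y) =
      (if (a, b) = (i, j) then (a, b, x + s * y, y)
       else if (a, b) = (j, i) then (a, b, x, y + s * x) else (a, b, x, y))" for x y
    unfolding s_def by (cases c) (simp_all only: if_True if_False th_lam[OF ij] th_inv_lam[OF ij] shear.simps, simp)
  have step: "th (ev (l # w)) (a, b, x, y) = th (if c then lam i j else inv (lam i j)) (a, b, \<alpha> * x + \<beta> * y, \<gamma> * x + \<delta> * y)" for x y
    using IH lam_closed[OF ij] ev_closed[OF w] by (simp add: l ev_Cons th_mult del: if_split_asm)
  consider "(a, b) = (i, j)" | "(a, b) \<noteq> (i, j)" "(a, b) = (j, i)" | "(a, b) \<noteq> (i, j)" "(a, b) \<noteq> (j, i)" by blast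
  then show ?case
  proof cases
    case 1
    show ?thesis unfolding step letter if_P[OF 1]
      by (rule exI[of _ "\<alpha> + s * \<gamma>"], rule exI[of _ "\<beta> + s * \<delta>"], rule exI[of _ \<gamma>], rule exI[of _ \<delta>])
         (simp add: algebra_simps)
  next
    case 2
    show ?thesis unfolding step letter if_not_P[OF 2(1)] if_P[OF 2(2)]
      by (rule exI[of _ \<alpha>], rule exI[of _ \<beta>], rule exI[of _ "\<gamma> + s * \<alpha>"], rule exI[of _ "\<delta> + s * \<beta>"])
         (simp add: algebra_simps)
  next
    case 3
    show ?thesis unfolding step letter if_not_P[OF 3(1)] if_not_P[OF 3(2)]
      by (rule exI[of _ \<alpha>], rule exI[of _ \<beta>], rule exI[of _ \<gamma>], rule exI[of _ \<delta>]) simp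
  qed
qed

section \<open>Ping-pong and faithfulness\<close>

definition scalar :: "'a \<Rightarrow> nat \<Rightarrow> nat \<Rightarrow> bool"
  where "scalar g a b \<longleftrightarrow> (\<exists>c. \<forall>x y. th g (a, b, x, y) = (a, b, c * x, c * y))"

text \<open>The four ping-pong regions of the plane: the first flag says which coordinate is the larger one, the
second whether the coordinates have equal or opposite signs. On the block \<open>(i, j)\<close>, the letters
\<open>lam i j\<close> and its inverse lead into the regions with first flag \<open>True\<close>, the letters \<open>lam j i\<close> and its
inverse into those with \<open>False\<close>; the second flag is the sign of the exponent. Keeping track of the sign
lets the argument proceed letter by letter instead of syllable by syllable.\<close>

fun ping_pong :: "bool \<Rightarrow> bool \<Rightarrow> int \<Rightarrow> int \<Rightarrow> bool" where
  "ping_pong h c x y \<longleftrightarrow>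
    (if h then \<bar>y\<bar> < \<bar>x\<bar> else \<bar>x\<bar> < \<bar>y\<bar>) \<and>
    (if c then 0 < x \<and> 0 < y \<or> x < 0 \<and> y < 0 else 0 < x \<and> y < 0 \<or> x < 0 \<and> 0 < y)"

text \<open>Each letter maps its own region and the two regions of the other kind into its own region; only the
region of the inverse letter is excluded, and it does not occur in a reduced word. Starting from a
vector on a coordinate axis, a nonempty reduced word ends in a region, hence off both axes, whereas a
scalar preserves the axes.\<close>

lemma reduced_not_scalar:
  assumes ij: "(i, j) \<in> pairs" and "w \<in> words {(i, j), (j, i)}" "reduced w" "w \<noteq> []"
  shows "\<not> scalar (ev w) i j"
proof -
  have ji: "(j, i) \<in> pairs" and ne: "i \<noteq> j" using ij by auto
  have letter: "th (if c then lamp p else inv (lamp p)) (i, j, x, y) =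
      (i, j, if p = (i, j) then (if c then x + 2 * y else x - 2 * y, y)
             else (x, if c then y + 2 * x else y - 2 * x))"
    if "p = (i, j) \<or> p = (j, i)" for p c x y
    using that ne th_lam[OF ij] th_inv_lam[OF ij] th_lam[OF ji] th_inv_lam[OF ji] by auto
  have main: "\<exists>u v x y. (u = 0 \<or> v = 0) \<and> th (ev w) (i, j, u, v) = (i, j, x, y) \<and>
      ping_pong (fst (hd w) = (i, j)) (snd (hd w)) x y"
    using assms(2-4)
  proof (induction w)
    case (Cons l w)
    obtain p c where l: "l = (p, c)" by (cases l)
    have p: "p = (i, j) \<or> p = (j, i)" and w: "w \<in> words {(i, j), (j, i)}" using Cons.prems l by auto
    then have w': "w \<in> words pairs" using ij ji by (auto simp: words_def)
    have pc: "lamp p \<in> carrier G" using p ij ji by auto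
    have step: "th (ev (l # w)) z = th (if c then lamp p else inv (lamp p)) (th (ev w) z)" for z
      using pc ev_closed[OF w'] by (simp add: l ev_Cons th_mult)
    show ?case
    proof (cases w)
      case Nil
      have 1: "th (ev (l # w)) (i, j, u, v) = (i, j, if p = (i, j) then (if c then u + 2 * v else u - 2 * v, v)
             else (u, if c then v + 2 * u else v - 2 * u))" for u v
        unfolding step unfolding Nil ev_Nil th_one by (rule letter[OF p])
      \<comment> \<open>The axis is chosen so that the first letter to act moves it.\<close>
      show ?thesis
      proof (cases "p = (i, j)")
        case True
        show ?thesis
          by (rule exI[of _ 0], rule exI[of _ 1], rule exI[of _ "if c then 2 else - 2"], rule exI[of _ 1])
             (simp add: 1 True, simp add: l True)
      next
        case False
        show ?thesis
          by (rule exI[of _ 1], rule exI[of _ 0], rule exI[of _ 1], rule exI[of _ "if c then 2 else - 2"])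
             (simp add: 1 False, simp add: l False)
      qed
    next
      case (Cons l' w'')
      obtain q d where l': "l' = (q, d)" by (cases l')
      have q: "q = (i, j) \<or> q = (j, i)" using w Cons l' by auto
      have nc: "(p, c) \<noteq> (q, \<not> d)" using Cons.prems(2) unfolding l l' \<open>w = l' # w''\<close> by (rule reduced_hd)
      obtain u v x y where IH: "u = 0 \<or> v = 0" "th (ev w) (i, j, u, v) = (i, j, x, y)"
          "ping_pong (q = (i, j)) d x y"
        using Cons.IH[OF w reduced_tl[OF Cons.prems(2)]] Cons l' by auto
      have "th (ev (l # w)) (i, j, u, v) = (i, j, if p = (i, j) then (if c then x + 2 * y else x - 2 * y, y)
             else (x, if c then y + 2 * x else y - 2 * x))"
        by (simp only: step IH(2) letter[OF p])
      moreover have "p = (i, j) \<Longrightarrow> ping_pong True c (if c then x + 2 * y else x - 2 * y) y"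
        using IH(3) nc q ne by (cases c; cases d; auto)
      moreover have "p \<noteq> (i, j) \<Longrightarrow> ping_pong False c x (if c then y + 2 * x else y - 2 * x)"
        using IH(3) nc p q ne by (cases c; cases d; auto)
      ultimately show ?thesis
        using IH(1) l by (cases "p = (i, j)") (fastforce simp del: ping_pong.simps)+
    qed
  qed simp
  show ?thesis
  proof
    assume "scalar (ev w) i j"
    then obtain c where c: "\<And>x y. th (ev w) (i, j, x, y) = (i, j, c * x, c * y)"
      by (auto simp: scalar_def)
    from main show False by (auto simp: c split: if_splits)
  qed
qed

text \<open>Cancel adjacent inverse letters until the word is reduced, hence empty.\<close>

lemma block_word_trivial:
  assumes ij: "(i, j) \<in> pairs"
  shows "w \<in> words {(i, j), (j, i)} \<Longrightarrow> scalar (ev w) i j \<Longrightarrow> ev w = \<one>"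
proof (induction "length w" arbitrary: w rule: less_induct)
  case less
  show ?case
  proof (cases "w = []")
    case False
    then have "\<not> reduced w" using reduced_not_scalar[OF ij less.prems(1)] less.prems(2) by blast
    then obtain u v p b where w: "w = u @ (p, b) # (p, \<not> b) # v" unfolding reduced_def by blast
    have sub: "x \<in> words {(i, j), (j, i)} \<Longrightarrow> x \<in> words pairs" for x using ij by (auto simp: words_def)
    have uv: "u \<in> words {(i, j), (j, i)}" "v \<in> words {(i, j), (j, i)}" "p \<in> {(i, j), (j, i)}"
      using less.prems(1) by (auto simp: w)
    then have uv': "u \<in> words pairs" "v \<in> words pairs" "p \<in> pairs" using sub ij by auto
    have pc: "lamp p \<in> carrier G" using uv'(3) lamp_funcset by blast
    have "ev ((p, b) # (p, \<not> b) # v) = ev v"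
      using pc ev_closed[OF uv'(2)] by (simp add: ev_Cons G.inv_cancel)
    moreover have "(p, b) # (p, \<not> b) # v \<in> words pairs" using uv' by simp
    ultimately have "ev w = ev (u @ v)"
      using ev_append uv' by (simp add: w)
    moreover have "length (u @ v) < length w" by (simp add: w)
    ultimately show ?thesis using less.hyps[of "u @ v"] less.prems uv by simp
  qed (simp add: ev_Nil)
qed

lemma letter_closed: "(i, j) \<in> pairs \<Longrightarrow> (if c then lam i j else inv (lam i j)) \<in> carrier G"
  using lam_closed[of i j] by simp

lemma commute_letter_ev:
  assumes "(k, l) \<in> pairs" "w \<in> words pairs" "\<And>p c. (p, c) \<in> set w \<Longrightarrow> {fst p, snd p} \<noteq> {k, l}"
  shows "commute G (if c then lam k l else inv (lam k l)) (ev w)"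
  using assms(2,3)
proof (induction w)
  case Nil
  then show ?case using lam_closed[OF assms(1)] by (simp add: ev_Nil commute_def)
next
  case (Cons x w)
  obtain i j b where x: "x = ((i, j), b)" by (metis prod.exhaust)
  have ij: "(i, j) \<in> pairs" and w: "w \<in> words pairs" and ne: "{i, j} \<noteq> {k, l}"
    using Cons.prems(1) Cons.prems(2)[of "(i, j)" b] x by auto
  have c: "lam i j \<in> carrier G" "lam k l \<in> carrier G" by (rule lam_closed[OF ij], rule lam_closed[OF assms(1)])
  have 1: "commute G (lam k l) (lam i j)" by (rule commute_lam[OF assms(1) ij ne[symmetric]])
  then have 2: "commute G (lam k l) (inv (lam i j))"
    using c G.intertwine_inv[of "lam k l" "lam i j" "lam i j"] by (simp add: commute_def)
  have "commute G (inv (lam k l)) y" if "y \<in> carrier G" "commute G (lam k l) y" for y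
    using that c G.intertwine_inv[of y "lam k l" "lam k l"] by (simp add: commute_def)
  then have "commute G (if c then lam k l else inv (lam k l)) (if b then lam i j else inv (lam i j))"
    using 1 2 c by simp
  moreover have "commute G (if c then lam k l else inv (lam k l)) (ev w)"
    by (rule Cons.IH[OF w], rule Cons.prems(2), rule list.set_intros(2))
  ultimately have "commute G (if c then lam k l else inv (lam k l)) ((if b then lam i j else inv (lam i j)) \<otimes> ev w)"
    using c ev_closed[OF w] by (intro G.commute_mult) auto
  then show ?case by (simp only: x ev_Cons prod.case)
qed

abbreviation in_block :: "nat \<Rightarrow> nat \<Rightarrow> (nat \<times> nat) \<times> bool \<Rightarrow> bool"
  where "in_block i j x \<equiv> {fst (fst x), snd (fst x)} = {i, j}"

lemma ev_block_split:
  assumes "w \<in> words pairs"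
  shows "ev w = ev (filter (in_block i j) w) \<otimes> ev (filter (\<lambda>x. \<not> in_block i j x) w)"
  using assms
proof (induction w)
  case Nil
  then show ?case by (simp add: ev_Nil)
next
  case (Cons x w)
  obtain k l b where x: "x = ((k, l), b)" by (metis prod.exhaust)
  define F N where "F = filter (in_block i j) w" and "N = filter (\<lambda>x. \<not> in_block i j x) w"
  have kl: "(k, l) \<in> pairs" and w: "w \<in> words pairs" using Cons.prems x by auto
  have FN: "F \<in> words pairs" "N \<in> words pairs" using w by (auto simp: F_def N_def words_def)
  let ?l = "if b then lam k l else inv (lam k l)"
  have c: "?l \<in> carrier G" "ev F \<in> carrier G" "ev N \<in> carrier G"
    using letter_closed[OF kl, of b] ev_closed FN by auto
  have IH: "ev w = ev F \<otimes> ev N" using Cons.IH[OF w] by (simp add: F_def N_def)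
  have ex: "ev (x # u) = ?l \<otimes> ev u" for u by (simp only: x ev_Cons prod.case)
  show ?case
  proof (cases "in_block i j x")
    case True
    then have "filter (in_block i j) (x # w) = x # F" "filter (\<lambda>x. \<not> in_block i j x) (x # w) = N"
      by (simp_all add: F_def N_def)
    then show ?thesis using c by (simp only: ex IH G.m_assoc)
  next
    case False
    then have f: "filter (in_block i j) (x # w) = F" "filter (\<lambda>x. \<not> in_block i j x) (x # w) = x # N"
      by (simp_all add: F_def N_def)
    have "commute G ?l (ev F)"
    proof (rule commute_letter_ev[OF kl FN(1)])
      fix p c assume "(p, c) \<in> set F"
      then have "{fst p, snd p} = {i, j}" by (simp add: F_def)
      then show "{fst p, snd p} \<noteq> {k, l}" using False by (simp add: x)
    qed
    then have "?l \<otimes> ev F = ev F \<otimes> ?l" by (simp add: commute_def)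
    then have "?l \<otimes> (ev F \<otimes> ev N) = ev F \<otimes> (?l \<otimes> ev N)"
      using G.m_assoc[OF c(1-3)] G.m_assoc[OF c(2,1,3)] by simp
    then show ?thesis by (simp only: f ex IH)
  qed
qed

lemma th_ev_fixes:
  assumes "w \<in> words pairs" "\<And>x. x \<in> set w \<Longrightarrow> \<not> in_block a b x"
  shows "th (ev w) (a, b, x, y) = (a, b, x, y)"
  using assms
proof (induction w)
  case Nil
  then show ?case by (simp add: ev_Nil th_one)
next
  case (Cons l w)
  obtain i j c where l: "l = ((i, j), c)" by (metis prod.exhaust)
  have ij: "(i, j) \<in> pairs" and w: "w \<in> words pairs" using Cons.prems l by auto
  have "{a, b} \<noteq> {i, j}" using Cons.prems(2)[of l] by (auto simp: l)
  have "th (ev w) (a, b, x, y) = (a, b, x, y)"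
    by (rule Cons.IH[OF w], rule Cons.prems(2), rule list.set_intros(2))
  then show ?case
    unfolding l ev_Cons prod.case th_mult[OF letter_closed[OF ij] ev_closed[OF w]]
    by (simp only: th_letter_fixes[OF ij \<open>{a, b} \<noteq> {i, j}\<close>])
qed

text \<open>The first letter of \<open>w\<close> belongs to some pair \<open>{i, j}\<close>. The letters of that pair can be collected in front,
and the others act trivially on the block \<open>(i, j)\<close>. So the collected word is scalar there and equals the
identity; dropping it gives a shorter word for the same element.\<close>

lemma scalar_everywhere_trivial:
  "w \<in> words pairs \<Longrightarrow> (\<And>i j. (i, j) \<in> pairs \<Longrightarrow> scalar (ev w) i j) \<Longrightarrow> ev w = \<one>"
proof (induction "length w" arbitrary: w rule: less_induct)
  case less
  show ?case
  proof (cases w)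
    case Nil
    then show ?thesis by (simp add: ev_Nil)
  next
    case (Cons l w')
    obtain i j c where l: "l = ((i, j), c)" by (metis prod.exhaust)
    have ij: "(i, j) \<in> pairs" using less.prems(1) by (simp add: Cons l)
    define F N where "F = filter (in_block i j) w" and "N = filter (\<lambda>x. \<not> in_block i j x) w"
    have FN: "F \<in> words pairs" "N \<in> words pairs" using less.prems(1) by (auto simp: F_def N_def words_def)
    have split: "ev w = ev F \<otimes> ev N" unfolding F_def N_def by (rule ev_block_split[OF less.prems(1)])
    have "th (ev N) (i, j, x, y) = (i, j, x, y)" for x y
      by (rule th_ev_fixes[OF FN(2)]) (auto simp: N_def)
    then have "scalar (ev F) i j"
      using less.prems(2)[OF ij] ev_closed[OF FN(1)] ev_closed[OF FN(2)] by (simp add: scalar_def split th_mult)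
    moreover have "F \<in> words {(i, j), (j, i)}"
      by (auto simp: words_def F_def doubleton_eq_iff)
    ultimately have "ev F = \<one>" by (intro block_word_trivial[OF ij])
    then have eq: "ev w = ev N" using split ev_closed[OF FN(2)] by simp
    have "length N < length w"
      unfolding N_def by (rule length_filter_less[of l]) (auto simp: Cons l)
    then show ?thesis using less.hyps[of N] FN(2) less.prems(2) eq by simp
  qed
qed

end

context uvb_action
begin

section \<open>The pure subgroup inside the group\<close>

definition pure :: "'a set"
  where "pure = {g \<in> carrier G. \<phi> g = id}"

lemma pure_closed [simp]: "p \<in> pure \<Longrightarrow> p \<in> carrier G"
  and pure_perm [simp]: "p \<in> pure \<Longrightarrow> \<phi> p = id"
  unfolding pure_def by auto

lemma pureI: "p \<in> carrier G \<Longrightarrow> \<phi> p = id \<Longrightarrow> p \<in> pure"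
  unfolding pure_def by auto

definition block_matrix :: "'a \<Rightarrow> nat \<Rightarrow> nat \<Rightarrow> int \<Rightarrow> int \<Rightarrow> int \<Rightarrow> int \<Rightarrow> bool"
  where "block_matrix p a b \<alpha> \<beta> \<gamma> \<delta> \<longleftrightarrow>
    (\<forall>x y. th p (a, b, x, y) = (a, b, \<alpha> * x + \<beta> * y, \<gamma> * x + \<delta> * y))"

lemma th_block_matrix:
  "block_matrix p a b \<alpha> \<beta> \<gamma> \<delta> \<Longrightarrow> th p (a, b, x, y) = (a, b, \<alpha> * x + \<beta> * y, \<gamma> * x + \<delta> * y)"
  unfolding block_matrix_def by (elim allE)

lemma pure_block_matrix:
  assumes "p \<in> pure"
  obtains \<alpha> \<beta> \<gamma> \<delta> where "block_matrix p a b \<alpha> \<beta> \<gamma> \<delta>"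
proof -
  obtain w where w: "w \<in> words pairs" "p = ev w"
    using assms unfolding pure_def by (elim CollectE conjE) (rule kernel_eq_ev)
  have "\<exists>\<alpha> \<beta> \<gamma> \<delta>. block_matrix p a b \<alpha> \<beta> \<gamma> \<delta>"
    unfolding block_matrix_def w(2) by (rule th_ev_linear[OF w(1)])
  then show ?thesis by (elim exE) (rule that)
qed

lemma pure_scalar_trivial:
  assumes "p \<in> pure" "\<And>i j. (i, j) \<in> pairs \<Longrightarrow> scalar p i j"
  shows "p = \<one>"
proof -
  obtain w where w: "w \<in> words pairs" "p = ev w"
    using assms(1) unfolding pure_def by (elim CollectE conjE) (rule kernel_eq_ev)
  show ?thesis using scalar_everywhere_trivial[OF w(1)] assms(2) by (simp add: w(2))
qed

lemma th_block:
  assumes "g \<in> carrier G"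
  obtains x' y' where "th g (a, b, x, y) = (\<phi> g a, \<phi> g b, x', y')"
proof -
  obtain w h where w: "w \<in> words pairs" "h \<in> R" "g = ev w \<otimes> h"
    using ev_R_decomposition[OF assms] .
  have s: "\<phi> g = \<phi> h"
    using perm_mult[OF ev_closed[OF w(1)] R_closed[OF w(2)]] perm_ev[OF w(1)] by (simp add: w(3))
  have "ev w \<in> pure" by (rule pureI[OF ev_closed[OF w(1)] perm_ev[OF w(1)]])
  then obtain \<alpha> \<beta> \<gamma> \<delta> where M: "block_matrix (ev w) (\<phi> h a) (\<phi> h b) \<alpha> \<beta> \<gamma> \<delta>"
    by (rule pure_block_matrix)
  have "th g (a, b, x, y) = (\<phi> g a, \<phi> g b, \<alpha> * x + \<beta> * y, \<gamma> * x + \<delta> * y)"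
    using ev_closed[OF w(1)] w(2) unfolding s by (simp add: w(3) th_mult th_R th_block_matrix[OF M])
  then show ?thesis by (rule that)
qed

text \<open>The blocks record the permutation, so an element that acts trivially is pure, and it is scalar on every
block.\<close>

lemma th_faithful:
  assumes g: "g \<in> carrier G" and h: "h \<in> carrier G" and eq: "\<And>z. th g z = th h z"
  shows "g = h"
proof -
  define k where "k = inv h \<otimes> g"
  have k: "k \<in> carrier G" using g h by (simp add: k_def)
  have id: "th k z = z" for z using g h by (simp add: k_def th_mult eq th_inv)
  have "\<phi> k a = a" for a
    by (rule th_block[OF k, of a a 0 0]) (simp add: id)
  then have "k \<in> pure" by (intro pureI k) (simp add: fun_eq_iff)
  moreover have "scalar k i j" for i j
    unfolding scalar_def by (rule exI[of _ 1]) (simp add: id)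
  ultimately have "k = \<one>" by (rule pure_scalar_trivial)
  then show ?thesis using g h by (metis G.inv_cancel(1) G.r_one k_def)
qed

lemma lam_pure: "(i, j) \<in> pairs \<Longrightarrow> lam i j \<in> pure"
  by (intro pureI lam_closed perm_lam)

lemma th_lam_pow:
  fixes m :: nat
  assumes "(i, j) \<in> pairs"
  shows "th (lam i j [^] m) (i, j, x, y) = (i, j, x + 2 * int m * y, y)"
    and "th (lam i j [^] m) (j, i, x, y) = (j, i, x, y + 2 * int m * x)"
    and "{a, b} \<noteq> {i, j} \<Longrightarrow> th (lam i j [^] m) (a, b, x, y) = (a, b, x, y)"
proof -
  have c: "lam i j \<in> carrier G" by (rule lam_closed[OF assms])
  have ne: "i \<noteq> j" using assms by simp
  show "th (lam i j [^] m) (i, j, x, y) = (i, j, x + 2 * int m * y, y)"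
    by (induction m arbitrary: x) (simp_all add: th_one th_mult c th_lam[OF assms] algebra_simps)
  show "th (lam i j [^] m) (j, i, x, y) = (j, i, x, y + 2 * int m * x)"
    using ne by (induction m arbitrary: y) (simp_all add: th_one th_mult c th_lam[OF assms] algebra_simps)
  assume ab: "{a, b} \<noteq> {i, j}"
  then have "th (lam i j) (a, b, x, y) = (a, b, x, y)" by (auto simp: th_lam[OF assms])
  then show "th (lam i j [^] m) (a, b, x, y) = (a, b, x, y)"
    by (induction m) (simp_all add: th_one th_mult c)
qed

lemma conj_supported:
  assumes g: "g \<in> carrier G" and q: "q \<in> carrier G"
    and fixes_q: "\<And>a b x y. {a, b} \<noteq> {i, j} \<Longrightarrow> th q (a, b, x, y) = (a, b, x, y)"
    and ab: "{a, b} \<noteq> {\<phi> g i, \<phi> g j}"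
  shows "th (g \<otimes> q \<otimes> inv g) (a, b, x, y) = (a, b, x, y)"
proof -
  obtain x' y' where z: "th (inv g) (a, b, x, y) = (\<phi> (inv g) a, \<phi> (inv g) b, x', y')"
    using th_block[of "inv g" a b x y] g by auto
  have "\<phi> g (\<phi> (inv g) c) = c" for c
    using perm_mult[of g "inv g"] g perm_one by (simp add: fun_eq_iff del: hom_mult hom_inv)
  then have "{\<phi> (inv g) a, \<phi> (inv g) b} \<noteq> {i, j}"
    using ab by (metis doubleton_eq_iff)
  then have "th q (th (inv g) (a, b, x, y)) = th (inv g) (a, b, x, y)"
    unfolding z by (rule fixes_q)
  then show ?thesis using g q by (simp add: th_mult th_inv)
qed

text \<open>Choose \<open>i\<close> not fixed and \<open>j\<close> different from \<open>i\<close> and its image. Then the image of \<open>i\<close> is outside \<open>{i, j}\<close>.\<close>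

lemma moved_pair:
  assumes "g \<in> carrier G" "\<phi> g \<noteq> id"
  obtains i j where "(i, j) \<in> pairs" "{\<phi> g i, \<phi> g j} \<noteq> {i, j}"
proof -
  obtain i where i: "\<phi> g i \<noteq> i" using assms(2) by (auto simp: fun_eq_iff)
  then have "i \<in> {1..n}" using permutes_not_in[OF permutes_perm[OF assms(1)]] by metis
  have "card {i, \<phi> g i} < card {1..n}" using n_ge i by simp
  then have "\<not> {1..n} \<subseteq> {i, \<phi> g i}" using card_mono[of "{i, \<phi> g i}" "{1..n}"] by auto
  then obtain j where "j \<in> {1..n}" "j \<noteq> i" "j \<noteq> \<phi> g i" by blast
  then show ?thesis using that[of i j] i \<open>i \<in> {1..n}\<close> by (auto simp: doubleton_eq_iff)
qed

lemma th_lam_moves: "(i, j) \<in> pairs \<Longrightarrow> 0 < m \<Longrightarrow> th (lam i j [^] (m::nat)) (i, j, 0, 1) \<noteq> (i, j, 0, 1)"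
  using th_lam_pow(1)[of i j m 0 1] by simp

text \<open>If \<open>g\<close> moved a pair \<open>{i, j}\<close>, the conjugate of \<open>lam i j\<close> by \<open>g\<close> would act on different blocks than
\<open>lam i j\<close>. So \<open>g\<close> is pure, and a matrix that commutes with both shears of a block is scalar.\<close>

lemma pure_centralizer:
  assumes g: "g \<in> carrier G" and comm: "\<And>p. p \<in> pure \<Longrightarrow> g \<otimes> p = p \<otimes> g"
  shows "g = \<one>"
proof -
  have "\<phi> g = id"
  proof (rule ccontr)
    assume "\<phi> g \<noteq> id"
    then obtain i j where ij: "(i, j) \<in> pairs" and ne: "{\<phi> g i, \<phi> g j} \<noteq> {i, j}"
      by (rule moved_pair[OF g])
    have c: "lam i j [^] (1::nat) \<in> carrier G" "lam i j \<in> carrier G" using lam_closed[OF ij] by auto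
    have "th (g \<otimes> lam i j [^] (1::nat) \<otimes> inv g) (i, j, 0, 1) = (i, j, 0, 1)"
      by (rule conj_supported[OF g c(1) th_lam_pow(3)[OF ij] ne[symmetric]])
    moreover have "g \<otimes> lam i j [^] (1::nat) \<otimes> inv g = lam i j [^] (1::nat)"
      using comm[OF lam_pure[OF ij]] g c(2) by (intro G.conj_eq_iff[THEN iffD2]) simp_all
    ultimately show False using th_lam_moves[OF ij, of 1] by simp
  qed
  then have "g \<in> pure" by (rule pureI[OF g])
  then show ?thesis
  proof (rule pure_scalar_trivial)
    fix i j assume ij: "(i, j) \<in> pairs"
    then have ji: "(j, i) \<in> pairs" and ne: "i \<noteq> j" by auto
    obtain \<alpha> \<beta> \<gamma> \<delta> where "block_matrix g i j \<alpha> \<beta> \<gamma> \<delta>"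
      by (rule pure_block_matrix[OF \<open>g \<in> pure\<close>])
    note M = th_block_matrix[OF this]
    have "th g (th p z) = th p (th g z)" if "p \<in> pure" for p z
      using comm[OF that] g that by (simp flip: th_mult)
    from this[OF lam_pure[OF ij], of "(i, j, 0, 1)"] this[OF lam_pure[OF ji], of "(i, j, 1, 0)"]
    have "\<beta> = 0" "\<gamma> = 0" "\<alpha> = \<delta>"
      using ne by (simp_all add: th_lam[OF ij] th_lam[OF ji] M)
    then show "scalar g i j" unfolding scalar_def by (intro exI[of _ \<alpha>]) (simp add: M)
  qed
qed

lemma pure_conj: "g \<in> carrier G \<Longrightarrow> p \<in> pure \<Longrightarrow> g \<otimes> p \<otimes> inv g \<in> pure"
  using H.r_inv[of "\<phi> g"] by (intro pureI) simp_all

lemma scalar_conj: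
  assumes g: "g \<in> pure" and p: "p \<in> pure" and sc: "scalar (g \<otimes> p \<otimes> inv g) a b"
  shows "scalar p a b"
proof -
  obtain c where c: "\<And>x y. th (g \<otimes> p \<otimes> inv g) (a, b, x, y) = (a, b, c * x, c * y)"
    using sc by (auto simp: scalar_def)
  obtain \<alpha> \<beta> \<gamma> \<delta> where "block_matrix g a b \<alpha> \<beta> \<gamma> \<delta>"
    by (rule pure_block_matrix[OF g])
  note M = th_block_matrix[OF this]
  have "th g (th p (a, b, x, y)) = th g (a, b, c * x, c * y)" for x y
  proof -
    have "th g (th p (a, b, x, y)) = th (g \<otimes> p \<otimes> inv g) (th g (a, b, x, y))"
      using g p by (simp add: th_mult th_inv)
    then show ?thesis by (simp add: M c algebra_simps)
  qed
  then show ?thesis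
    unfolding scalar_def using th_inj[of g] g by (intro exI[of _ c]) simp
qed

text \<open>The elements \<open>lam i j\<close> and \<open>lam j i\<close> provide the two shears of \<open>commuting_shears_scalar\<close>, with entry
\<open>t = 2 m\<close>.\<close>

lemma pure_noncommuting:
  fixes m :: nat
  assumes m: "0 < m" and p: "p \<in> pure" "\<not> scalar p i j" and q: "q \<in> pure" "\<not> scalar q i j"
    and ij: "(i, j) \<in> pairs"
  shows "\<exists>u\<in>{\<one>, lam i j, lam j i}. \<not> commute G (u [^] m \<otimes> p \<otimes> inv (u [^] m)) q"
proof (rule ccontr)
  assume "\<not> ?thesis"
  then have comm: "commute G (u [^] m \<otimes> p \<otimes> inv (u [^] m)) q" if "u \<in> {\<one>, lam i j, lam j i}" for u
    using that by metis
  have ji: "(j, i) \<in> pairs" and ne: "i \<noteq> j" using ij by auto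
  have cl: "p \<in> carrier G" "q \<in> carrier G" "lam i j \<in> carrier G" "lam j i \<in> carrier G"
    using p q lam_closed[OF ij] lam_closed[OF ji] by auto
  obtain a b c d where bp: "block_matrix p i j a b c d"
    by (rule pure_block_matrix[OF p(1)])
  obtain a' b' c' d' where bq: "block_matrix q i j a' b' c' d'"
    by (rule pure_block_matrix[OF q(1)])
  note P = th_block_matrix[OF bp] and Q = th_block_matrix[OF bq]
  define t where "t = 2 * int m"
  have t: "t \<noteq> 0" using m by (simp add: t_def)
  have U: "th (lam i j [^] m) (i, j, x, y) = (i, j, x + t * y, y)" for x y
    using th_lam_pow(1)[OF ij] by (simp add: t_def)
  have L: "th (lam j i [^] m) (i, j, x, y) = (i, j, x, y + t * x)" for x y
    using th_lam_pow(2)[OF ji] by (simp add: t_def)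
  have Ui: "th (inv (lam i j [^] m)) (i, j, x, y) = (i, j, x - t * y, y)" for x y
    using th_inv(1)[of "lam i j [^] m" "(i, j, x - t * y, y)"] cl by (simp add: U)
  have Li: "th (inv (lam j i [^] m)) (i, j, x, y) = (i, j, x, y - t * x)" for x y
    using th_inv(1)[of "lam j i [^] m" "(i, j, x, y - t * x)"] cl by (simp add: L)
  have entries: "k2 * c' = b' * k3 \<and> (k1 - k4) * b' = (a' - d') * k2 \<and> (k1 - k4) * c' = (a' - d') * k3"
    if "k \<in> carrier G" "commute G k q" "block_matrix k i j k1 k2 k3 k4"
    for k k1 k2 k3 k4
  proof -
    have "th k (th q z) = th q (th k z)" for z
      using that(1,2) cl by (simp add: commute_def flip: th_mult)
    from this[of "(i, j, 1, 0)"] this[of "(i, j, 0, 1)"] show ?thesis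
      by (simp add: th_block_matrix[OF that(3)] Q algebra_simps)
  qed
  have 1: "b * c' = b' * c \<and> (a - d) * b' = (a' - d') * b \<and> (a - d) * c' = (a' - d') * c"
    using comm[of \<one>] cl by (intro entries[of p] bp) auto
  have 2: "(b - t * (a - d) - t * t * c) * c' = b' * c \<and>
      ((a + t * c) - (d - t * c)) * b' = (a' - d') * (b - t * (a - d) - t * t * c) \<and>
      ((a + t * c) - (d - t * c)) * c' = (a' - d') * c"
    using comm[of "lam i j"] cl
    by (intro entries[of "lam i j [^] m \<otimes> p \<otimes> inv (lam i j [^] m)"])
       (auto simp: block_matrix_def th_mult U Ui P algebra_simps)
  have 3: "b * c' = b' * (c + t * (a - d) - t * t * b) \<and>
      ((a - t * b) - (d + t * b)) * b' = (a' - d') * b \<and>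
      ((a - t * b) - (d + t * b)) * c' = (a' - d') * (c + t * (a - d) - t * t * b)"
    using comm[of "lam j i"] cl
    by (intro entries[of "lam j i [^] m \<otimes> p \<otimes> inv (lam j i [^] m)"])
       (auto simp: block_matrix_def th_mult L Li P algebra_simps)
  have "(b = 0 \<and> c = 0 \<and> a = d) \<or> (b' = 0 \<and> c' = 0 \<and> a' = d')"
    by (rule commuting_shears_scalar[OF t]) (use 1 2 3 in \<open>simp_all add: algebra_simps\<close>)
  then show False
  proof
    assume "b = 0 \<and> c = 0 \<and> a = d"
    then have "scalar p i j" unfolding scalar_def by (intro exI[of _ a]) (simp add: P)
    then show False using p(2) by simp
  next
    assume "b' = 0 \<and> c' = 0 \<and> a' = d'"
    then have "scalar q i j" unfolding scalar_def by (intro exI[of _ a']) (simp add: Q)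
    then show False using q(2) by simp
  qed
qed

text \<open>A condition in the language of groups that singles out the pure elements when \<open>m\<close>-th powers are pure.\<close>

definition separated :: "nat \<Rightarrow> 'a \<Rightarrow> bool"
  where "separated m g \<longleftrightarrow> (\<forall>y\<in>carrier G. y [^] m \<noteq> \<one> \<longrightarrow>
    (\<exists>u\<in>carrier G. \<not> commute G (u [^] m \<otimes> y [^] m \<otimes> inv (u [^] m)) (g \<otimes> y [^] m \<otimes> inv g)))"

text \<open>Restricting to \<open>m\<close>-th powers makes both \<open>x = y\<^sup>m\<close> and the conjugating element pure, so both preserve the
blocks. For pure \<open>g\<close>, a block on which \<open>x\<close> is not scalar supplies a noncommuting conjugate. For other
\<open>g\<close>, take \<open>x = (lam i j)\<^sup>m\<close> for a moved pair: all conjugates in question have supports disjoint from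
that of \<open>g x g\<^sup>-\<^sup>1\<close>, and elements with disjoint supports commute by faithfulness.\<close>

lemma pure_iff_separated:
  fixes m :: nat
  assumes m: "0 < m" and pow: "\<And>g. g \<in> carrier G \<Longrightarrow> g [^] m \<in> pure" and g: "g \<in> carrier G"
  shows "g \<in> pure \<longleftrightarrow> separated m g"
proof
  assume gp: "g \<in> pure"
  show "separated m g"
    unfolding separated_def
  proof (intro ballI impI)
    fix y assume y: "y \<in> carrier G" "y [^] m \<noteq> \<one>"
    obtain i j where ij: "(i, j) \<in> pairs" and ns: "\<not> scalar (y [^] m) i j"
      using pure_scalar_trivial[OF pow[OF y(1)]] y(2) by blast
    have "\<not> scalar (g \<otimes> y [^] m \<otimes> inv g) i j"
      using scalar_conj[OF gp pow[OF y(1)]] ns by blast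
    from pure_noncommuting[OF m pow[OF y(1)] ns pure_conj[OF g pow[OF y(1)]] this ij]
    obtain u where u: "u \<in> {\<one>, lam i j, lam j i}"
      "\<not> commute G (u [^] m \<otimes> y [^] m \<otimes> inv (u [^] m)) (g \<otimes> y [^] m \<otimes> inv g)" by (elim bexE)
    moreover have "(j, i) \<in> pairs" using ij by auto
    then have "u \<in> carrier G" using u(1) lam_closed[OF ij] lam_closed[of j i] by auto
    ultimately show "\<exists>u\<in>carrier G. \<not> commute G (u [^] m \<otimes> y [^] m \<otimes> inv (u [^] m)) (g \<otimes> y [^] m \<otimes> inv g)"
      by (intro bexI[of _ u])
  qed
next
  assume sep: "separated m g"
  show "g \<in> pure"
  proof (rule ccontr)
    assume "g \<notin> pure"
    then have "\<phi> g \<noteq> id" using pureI[OF g] by metis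
    then obtain i j where ij: "(i, j) \<in> pairs" and ne: "{\<phi> g i, \<phi> g j} \<noteq> {i, j}"
      by (rule moved_pair[OF g])
    define x where "x = lam i j [^] m"
    have x: "x \<in> carrier G" "lam i j \<in> carrier G" using lam_closed[OF ij] by (auto simp: x_def)
    have "x \<noteq> \<one>" using th_lam_moves[OF ij m] by (auto simp: x_def th_one)
    then obtain u where u: "u \<in> carrier G" and nc: "\<not> commute G (u [^] m \<otimes> x \<otimes> inv (u [^] m)) (g \<otimes> x \<otimes> inv g)"
      using sep x(2) by (auto simp: separated_def x_def)
    define v where "v = u [^] m"
    have v: "v \<in> pure" "v \<in> carrier G" using pow[OF u] by (auto simp: v_def)
    define p q where "p = v \<otimes> x \<otimes> inv v" and "q = g \<otimes> x \<otimes> inv g"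
    have xp: "x \<in> pure" using pow[OF x(2)] by (simp add: x_def)
    have pq: "p \<in> pure" "q \<in> pure" using pure_conj v(2) g xp by (simp_all add: p_def q_def)
    have xs: "th x (a, b, s, t) = (a, b, s, t)" if "{a, b} \<noteq> {i, j}" for a b s t
      unfolding x_def by (rule th_lam_pow(3)[OF ij that])
    have ps: "th p (a, b, s, t) = (a, b, s, t)" if "{a, b} \<noteq> {i, j}" for a b s t
      unfolding p_def by (rule conj_supported[OF v(2) x(1) xs]) (use that v(1) in simp_all)
    have qs: "th q (a, b, s, t) = (a, b, s, t)" if "{a, b} \<noteq> {\<phi> g i, \<phi> g j}" for a b s t
      unfolding q_def by (rule conj_supported[OF g x(1) xs that])
    have "th (p \<otimes> q) z = th (q \<otimes> p) z" for z
    proof -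
      obtain a b s t where z: "z = (a, b, s, t)" by (metis prod.exhaust)
      obtain s1 t1 where 1: "th p (a, b, s, t) = (a, b, s1, t1)"
        by (rule th_block[OF pure_closed[OF pq(1)], of a b s t]) (simp add: pq)
      obtain s2 t2 where 2: "th q (a, b, s, t) = (a, b, s2, t2)"
        by (rule th_block[OF pure_closed[OF pq(2)], of a b s t]) (simp add: pq)
      consider "{a, b} \<noteq> {i, j}" | "{a, b} \<noteq> {\<phi> g i, \<phi> g j}" using ne by auto
      then show ?thesis
        using ps qs pq 1 2 by cases (simp_all add: z th_mult)
    qed
    then have "p \<otimes> q = q \<otimes> p" using pq by (intro th_faithful) simp_all
    then show False using nc by (simp add: commute_def p_def q_def v_def)
  qed
qed

lemma separated_auto:
  assumes f: "f \<in> auto G" and g: "g \<in> carrier G"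
  shows "separated m (f g) \<longleftrightarrow> separated m g"
proof -
  interpret f: group_hom G G f using f by unfold_locales (simp add: auto_def)
  have im: "f ` carrier G = carrier G" and inj: "inj_on f (carrier G)"
    using auto_bij[OF f] by (simp_all add: bij_betw_def)
  have one: "f y = \<one> \<longleftrightarrow> y = \<one>" if "y \<in> carrier G" for y
    using inj_on_eq_iff[OF inj that G.one_closed] by simp
  have comm: "commute G (f x) (f y) \<longleftrightarrow> commute G x y" if "x \<in> carrier G" "y \<in> carrier G" for x y
    using inj_on_eq_iff[OF inj, of "x \<otimes> y" "y \<otimes> x"] that by (simp add: commute_def)
  have "separated m (f g) \<longleftrightarrow> (\<forall>y\<in>f ` carrier G. y [^] m \<noteq> \<one> \<longrightarrow>
    (\<exists>u\<in>f ` carrier G. \<not> commute G (u [^] m \<otimes> y [^] m \<otimes> inv (u [^] m)) (f g \<otimes> y [^] m \<otimes> inv (f g))))"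
    unfolding separated_def im ..
  also have "\<dots> \<longleftrightarrow> (\<forall>y\<in>carrier G. f (y [^] m) \<noteq> \<one> \<longrightarrow>
    (\<exists>u\<in>carrier G. \<not> commute G (f (u [^] m \<otimes> y [^] m \<otimes> inv (u [^] m))) (f (g \<otimes> y [^] m \<otimes> inv g))))"
    using g by (simp add: f.hom_nat_pow)
  also have "\<dots> \<longleftrightarrow> separated m g"
    unfolding separated_def using g by (simp add: one comm del: f.hom_mult f.hom_inv)
  finally show ?thesis .
qed

lemma pure_characteristic:
  fixes m :: nat
  assumes m: "0 < m" and pow: "\<And>g. g \<in> carrier G \<Longrightarrow> g [^] m \<in> pure" and f: "f \<in> auto G"
  shows "f ` pure = pure"
proof -
  have iff: "f g \<in> pure \<longleftrightarrow> g \<in> pure" if "g \<in> carrier G" for g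
    using that auto_closed[OF f] by (simp add: pure_iff_separated[OF m pow] separated_auto[OF f])
  have im: "f ` carrier G = carrier G" using auto_bij[OF f] by (simp add: bij_betw_def)
  show ?thesis
  proof (intro equalityI subsetI)
    fix p assume "p \<in> pure"
    then obtain g where "g \<in> carrier G" "p = f g" using im pure_closed by blast
    then show "p \<in> f ` pure" using iff \<open>p \<in> pure\<close> by blast
  qed (use iff in auto)
qed

end

section \<open>The unrestricted virtual braid group\<close>

text \<open>On each block at least one of the two shears is the identity.\<close>

lemma shear_commute:
  assumes "{i, j} \<noteq> {k, l}"
  shows "shear i j (shear k l z) = shear k l (shear i j z)"
proof -
  obtain a b x y where z: "z = (a, b, x, y)" by (metis prod.exhaust)
  have fixes_block: "shear c d (a, b, x, y) = (a, b, x, y)" if "{a, b} \<noteq> {c, d}" for c d x y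
    using that by auto
  have keeps_block: "shear c d (a, b, x, y) =
      (a, b, if (a, b) = (c, d) then x + 2 * y else x,
        if (a, b) \<noteq> (c, d) \<and> (a, b) = (d, c) then y + 2 * x else y)" for c d x y
    by simp
  consider "{a, b} \<noteq> {i, j}" | "{a, b} \<noteq> {k, l}" using assms by auto
  then show ?thesis
  proof cases
    case 1
    show ?thesis unfolding z keeps_block[of k l] fixes_block[OF 1] ..
  next
    case 2
    show ?thesis unfolding z keeps_block[of i j] fixes_block[OF 2] ..
  qed
qed

lemma perm_point_shear:
  assumes "inj s"
  shows "perm_point s (shear i j z) = shear (s i) (s j) (perm_point s z)"
  using inj_eq[OF assms] by (cases z) auto

lemma bij_shear: "i \<noteq> j \<Longrightarrow> bij (shear i j)"
proof (rule o_bij)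
  assume ij: "i \<noteq> j"
  define inverse_shear :: "point \<Rightarrow> point" where "inverse_shear = (\<lambda>(a, b, x, y).
    if (a, b) = (i, j) then (a, b, x - 2 * y, y)
    else if (a, b) = (j, i) then (a, b, x, y - 2 * x) else (a, b, x, y))"
  show "inverse_shear \<circ> shear i j = id" "shear i j \<circ> inverse_shear = id"
    using ij by (auto simp: fun_eq_iff inverse_shear_def)
qed

lemma bij_perm_point_transpose: "bij (perm_point (transpose i j))"
  by (rule o_bij[of "perm_point (transpose i j)"]) (auto simp: fun_eq_iff)

abbreviation swap_point :: "nat \<Rightarrow> point \<Rightarrow> point"
  where "swap_point i \<equiv> perm_point (transpose i (i + 1))"

fun gen_action :: "uvb_gen \<Rightarrow> point \<Rightarrow> point" where
  "gen_action (Rho i) = swap_point i"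
| "gen_action (Sigma i) = shear i (i + 1) \<circ> swap_point i"

lemma bij_gen_action: "bij (gen_action x)"
  by (cases x) (auto intro!: bij_comp bij_shear bij_perm_point_transpose simp del: One_nat_def)

lemma carrier_BijGroup_UNIV: "carrier (BijGroup UNIV) = {f. bij f}"
  by (auto simp: BijGroup_def Bij_def extensional_UNIV)

lemma mult_BijGroup_UNIV: "bij f \<Longrightarrow> bij g \<Longrightarrow> f \<otimes>\<^bsub>BijGroup UNIV\<^esub> g = f \<circ> g"
  by (auto simp: BijGroup_def Bij_def extensional_UNIV compose_def)

lemma one_BijGroup_UNIV: "\<one>\<^bsub>BijGroup UNIV\<^esub> = id"
  by (auto simp: BijGroup_def)

lemma gen_action_funcset: "gen_action \<in> S \<rightarrow> carrier (BijGroup UNIV)"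
  by (simp add: carrier_BijGroup_UNIV bij_gen_action)

lemma gen_action_eval:
  "word_eval (BijGroup UNIV) gen_action [] z = z"
  "word_eval (BijGroup UNIV) gen_action ((x, True) # w) z =
    gen_action x (word_eval (BijGroup UNIV) gen_action w z)"
proof -
  interpret B: group "BijGroup (UNIV :: point set)" by (rule group_BijGroup)
  show "word_eval (BijGroup UNIV) gen_action [] z = z"
    by (simp add: word_eval_def one_BijGroup_UNIV)
  have "w \<in> words UNIV" by (auto simp: words_def)
  then have "bij (word_eval (BijGroup UNIV) gen_action w)"
    using B.word_eval_closed[OF gen_action_funcset] by (simp add: carrier_BijGroup_UNIV)
  from mult_BijGroup_UNIV[OF bij_gen_action this]
  show "word_eval (BijGroup UNIV) gen_action ((x, True) # w) z =
    gen_action x (word_eval (BijGroup UNIV) gen_action w z)"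
    by (simp add: word_eval_def)
qed

lemma swap_point_shear:
  "swap_point i (shear a b z) = shear (transpose i (i + 1) a) (transpose i (i + 1) b) (swap_point i z)"
  by (rule perm_point_shear) simp

lemma swap_point_square: "swap_point i (swap_point i z) = z"
  by (cases z) simp

lemma swap_point_braid:
  "swap_point i (swap_point (i + 1) (swap_point i z)) = swap_point (i + 1) (swap_point i (swap_point (i + 1) z))"
proof -
  have "transpose i (i + 1) (transpose (i + 1) (i + 2) (transpose i (i + 1) a)) =
    transpose (i + 1) (i + 2) (transpose i (i + 1) (transpose (i + 1) (i + 2) a))" for a
  proof -
    consider "a = i" | "a = i + 1" | "a = i + 2" | "a \<noteq> i" "a \<noteq> i + 1" "a \<noteq> i + 2" by blast
    then show ?thesis by cases (simp_all add: transpose_def)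
  qed
  then show ?thesis by (cases z) simp
qed

lemma swap_point_commute:
  assumes "\<bar>int i - int j\<bar> > 1"
  shows "swap_point i (swap_point j z) = swap_point j (swap_point i z)"
proof -
  have d: "i \<noteq> j" "i + 1 \<noteq> j" "i \<noteq> j + 1" using assms by auto
  have "transpose i (i + 1) (transpose j (j + 1) a) = transpose j (j + 1) (transpose i (i + 1) a)" for a
  proof -
    consider "a = i" | "a = i + 1" | "a = j" | "a = j + 1" | "a \<noteq> i" "a \<noteq> i + 1" "a \<noteq> j" "a \<noteq> j + 1" by blast
    then show ?thesis using d by cases (simp_all add: transpose_def)
  qed
  then show ?thesis by (cases z) simp
qed

text \<open>Moving all block permutations to the right with \<open>swap_point_shear\<close> reduces each relation to a relation
between block permutations together with the commutation of shears of different pairs.\<close>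

lemma gen_action_rels:
  assumes "(u, v) \<in> uvb_rels n"
  shows "word_eval (BijGroup UNIV) gen_action u = word_eval (BijGroup UNIV) gen_action v"
proof -
  let ?P = swap_point
  let ?S = "\<lambda>i z. shear i (i + 1) (swap_point i z)"
  have P: "swap_point i (shear i (i + 1) z) = shear (i + 1) i (swap_point i z)"
    "swap_point i (shear (i + 1) (i + 2) z) = shear i (i + 2) (swap_point i z)"
    "swap_point i (shear i (i + 2) z) = shear (i + 1) (i + 2) (swap_point i z)"
    "swap_point (i + 1) (shear i (i + 1) z) = shear i (i + 2) (swap_point (i + 1) z)"
    "swap_point (i + 1) (shear i (i + 2) z) = shear i (i + 1) (swap_point (i + 1) z)" for i z
    unfolding swap_point_shear by (simp_all add: transpose_def)
  have far: "swap_point j (shear i (i + 1) z) = shear i (i + 1) (swap_point j z)"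
    if "\<bar>int i - int j\<bar> > 1" for i j z
  proof -
    have "i \<noteq> j" "i + 1 \<noteq> j" "i \<noteq> j + 1" using that by auto
    then show ?thesis unfolding swap_point_shear by (simp add: transpose_def)
  qed
  have sh: "shear i (i + 2) (shear i (i + 1) z) = shear i (i + 1) (shear i (i + 2) z)"
    "shear i (i + 2) (shear (i + 1) (i + 2) z) = shear (i + 1) (i + 2) (shear i (i + 2) z)"
    "shear (i + 1) (i + 2) (shear i (i + 1) z) = shear i (i + 1) (shear (i + 1) (i + 2) z)" for i z
    by (rule shear_commute; simp add: doubleton_eq_iff)+
  have two: "i + 1 + 1 = i + 2" for i :: nat by simp
  have 1: "?S i (?S (i + 1) (?S i z)) = ?S (i + 1) (?S i (?S (i + 1) z))" for i z
    unfolding two P[unfolded two] swap_point_braid[unfolded two] sh ..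
  have 2: "?S i (?S j z) = ?S j (?S i z)" if d: "\<bar>int i - int j\<bar> > 1" for i j z
  proof -
    have d': "\<bar>int j - int i\<bar> > 1" using d by auto
    have "shear i (i + 1) (shear j (j + 1) y) = shear j (j + 1) (shear i (i + 1) y)" for y
      by (rule shear_commute) (use d in \<open>auto simp: doubleton_eq_iff\<close>)
    then show ?thesis unfolding far[OF d] far[OF d'] swap_point_commute[OF d] by simp
  qed
  have 3: "?S i (?P j z) = ?P j (?S i z)" if "\<bar>int i - int j\<bar> > 1" for i j z
    unfolding far[OF that] swap_point_commute[OF that] ..
  have 4: "?S i (?P (i + 1) (?P i z)) = ?P (i + 1) (?P i (?S (i + 1) z))" for i z
    unfolding two P[unfolded two] swap_point_braid[unfolded two] ..
  have 5: "?P i (?S (i + 1) (?S i z)) = ?S (i + 1) (?S i (?P (i + 1) z))" for i z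
    unfolding two P[unfolded two] swap_point_braid[unfolded two] sh ..
  have 6: "?P (i + 1) (?S i (?S (i + 1) z)) = ?S i (?S (i + 1) (?P i z))" for i z
    unfolding two P[unfolded two] swap_point_braid[unfolded two] sh ..
  have "word_eval (BijGroup UNIV) gen_action u z = word_eval (BijGroup UNIV) gen_action v z" for z
    using assms unfolding uvb_rels_def
    by (elim UnE; elim CollectE exE conjE Pair_inject; hypsubst;
        simp only: gen_action_eval gen_action.simps o_apply)
       (erule 2 3 swap_point_commute | rule 1 4 5 6 swap_point_braid swap_point_square)+
  then show ?thesis by (rule ext)
qed

definition uvb_action_map :: "nat \<Rightarrow> uvb_gen word set \<Rightarrow> point \<Rightarrow> point"
  where "uvb_action_map n = presented_lift (BijGroup UNIV) gen_action"

definition uvb_class :: "nat \<Rightarrow> uvb_gen word \<Rightarrow> uvb_gen word set"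
  where "uvb_class n = word_class (uvb_gens n) (uvb_rels n)"

lemma uvb_action_map_hom: "uvb_action_map n \<in> hom (UVB n) (BijGroup UNIV)"
  unfolding uvb_action_map_def UVB_def
  by (rule group.hom_presented_lift(1)[OF group_BijGroup gen_action_funcset gen_action_rels])

lemma uvb_action_map_gen: "x \<in> uvb_gens n \<Longrightarrow> uvb_action_map n (uvb_class n [(x, True)]) = gen_action x"
  unfolding uvb_action_map_def uvb_class_def
  by (rule group.hom_presented_lift(2)[OF group_BijGroup gen_action_funcset gen_action_rels])

lemma uvb_class_closed: "u \<in> words (uvb_gens n) \<Longrightarrow> uvb_class n u \<in> carrier (UVB n)"
  by (simp add: UVB_def uvb_class_def carrier_presented_group)

lemma uvb_class_append:
  "u \<in> words (uvb_gens n) \<Longrightarrow> v \<in> words (uvb_gens n) \<Longrightarrow>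
    uvb_class n (u @ v) = uvb_class n u \<otimes>\<^bsub>UVB n\<^esub> uvb_class n v"
  by (simp add: UVB_def uvb_class_def mult_presented_group)

lemma uvb_class_Nil: "uvb_class n [] = \<one>\<^bsub>UVB n\<^esub>"
  by (simp add: UVB_def uvb_class_def one_presented_group)

lemma uvb_class_rel: "(u, v) \<in> uvb_rels n \<Longrightarrow> uvb_class n u = uvb_class n v"
  using uvb_rels_words[of u v n] word_cong.relation[of u v "uvb_rels n" "uvb_gens n"]
  by (simp add: uvb_class_def word_class_eq)

lemma uvb_class_inverse:
  assumes "x \<in> uvb_gens n"
  shows "uvb_class n [(x, False)] = inv\<^bsub>UVB n\<^esub> (uvb_class n [(x, True)])"
proof -
  interpret G: group "UVB n" by (rule group_UVB)
  have "([(x, False), (x, True)], []) \<in> word_cong (uvb_gens n) (uvb_rels n)"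
    using word_cong.cancel[OF assms, of False] by simp
  then have "uvb_class n ([(x, False)] @ [(x, True)]) = \<one>\<^bsub>UVB n\<^esub>"
    using assms unfolding uvb_class_Nil[symmetric] by (simp add: uvb_class_def word_class_eq)
  then show ?thesis
    using assms by (intro G.inv_equality[symmetric]) (simp_all add: uvb_class_append[symmetric] uvb_class_closed)
qed

lemma uvb_generated:
  "carrier (UVB n) = generate (UVB n) ((\<lambda>i. uvb_class n [sg i]) ` {1..<n} \<union> (\<lambda>i. uvb_class n [rh i]) ` {1..<n})"
    (is "_ = generate _ ?X")
proof -
  interpret G: group "UVB n" by (rule group_UVB)
  have X: "?X \<subseteq> carrier (UVB n)"
    by (auto intro!: uvb_class_closed simp: uvb_gens_def)
  have letter: "uvb_class n [(x, b)] \<in> generate (UVB n) ?X" if "x \<in> uvb_gens n" for x b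
  proof -
    have "uvb_class n [(x, True)] \<in> ?X" using that by (auto simp: uvb_gens_def)
    then show ?thesis
      using that by (cases b) (auto simp: uvb_class_inverse intro: generate.incl generate.inv)
  qed
  have "uvb_class n u \<in> generate (UVB n) ?X" if "u \<in> words (uvb_gens n)" for u
    using that
  proof (induction u)
    case Nil
    show ?case by (simp add: uvb_class_Nil generate.one)
  next
    case (Cons l u)
    obtain x b where l: "l = (x, b)" by (cases l)
    have "uvb_class n (l # u) = uvb_class n [l] \<otimes>\<^bsub>UVB n\<^esub> uvb_class n u"
      using Cons.prems uvb_class_append[of "[l]" n u] by simp
    then show ?case using Cons letter[of x b] by (simp add: l generate.eng)
  qed
  then have "carrier (UVB n) \<subseteq> generate (UVB n) ?X"
    by (auto simp: UVB_def carrier_presented_group uvb_class_def)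
  then show ?thesis using G.generate_incl[OF X] by blast
qed

lemma uvb_action_UVB:
  assumes "3 \<le> n"
  shows "uvb_action (UVB n) n (uvb_perm n) (\<lambda>i. uvb_class n [rh i]) (\<lambda>i. uvb_class n [sg i]) (uvb_action_map n)"
proof -
  interpret perm: group_hom "UVB n" "sym_group n" "uvb_perm n" by (rule group_hom_uvb_perm)
  let ?c = "uvb_class n"
  have gens: "Rho i \<in> uvb_gens n" "Sigma i \<in> uvb_gens n" if "1 \<le> i" "i < n" for i
    using that by (auto simp: uvb_gens_def)
  have c2: "?c [x, y] = ?c [x] \<otimes>\<^bsub>UVB n\<^esub> ?c [y]" if "fst x \<in> uvb_gens n" "fst y \<in> uvb_gens n" for x y
    using that uvb_class_append[of "[x]" n "[y]"] by simp
  have c3: "?c [x, y, z] = ?c [x] \<otimes>\<^bsub>UVB n\<^esub> ?c [y] \<otimes>\<^bsub>UVB n\<^esub> ?c [z]"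
    if "fst x \<in> uvb_gens n" "fst y \<in> uvb_gens n" "fst z \<in> uvb_gens n" for x y z
    using that uvb_class_append[of "[x, y]" n "[z]"] c2[of x y] by simp
  have rel2: "?c [x] \<otimes>\<^bsub>UVB n\<^esub> ?c [y] = ?c [y] \<otimes>\<^bsub>UVB n\<^esub> ?c [x]"
    if "fst x \<in> uvb_gens n" "fst y \<in> uvb_gens n" "([x, y], [y, x]) \<in> uvb_rels n" for x y
    using uvb_class_rel[OF that(3)] that(1,2) by (simp add: c2)
  have rel3: "?c [x] \<otimes>\<^bsub>UVB n\<^esub> ?c [y] \<otimes>\<^bsub>UVB n\<^esub> ?c [z] = ?c [x'] \<otimes>\<^bsub>UVB n\<^esub> ?c [y'] \<otimes>\<^bsub>UVB n\<^esub> ?c [z']"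
    if "([x, y, z], [x', y', z']) \<in> uvb_rels n" for x y z x' y' z'
    using uvb_class_rel[OF that] uvb_rels_words[OF that] by (simp add: c3)
  have th: "uvb_action_map n (g \<otimes>\<^bsub>UVB n\<^esub> h) z = uvb_action_map n g (uvb_action_map n h z)"
    if "g \<in> carrier (UVB n)" "h \<in> carrier (UVB n)" for g h z
  proof -
    have "bij (uvb_action_map n g)" "bij (uvb_action_map n h)"
      using that hom_in_carrier[OF uvb_action_map_hom[of n]] by (auto simp: carrier_BijGroup_UNIV)
    then show ?thesis
      using hom_mult[OF uvb_action_map_hom that] by (simp add: mult_BijGroup_UNIV)
  qed
  show ?thesis
  proof unfold_locales
    show "?c [rh i] \<in> carrier (UVB n)" "?c [sg i] \<in> carrier (UVB n)" if "1 \<le> i" "i < n" for i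
      using gens[OF that] by (simp_all add: uvb_class_closed)
    show "?c [rh i] \<otimes>\<^bsub>UVB n\<^esub> ?c [rh i] = \<one>\<^bsub>UVB n\<^esub>" if i: "1 \<le> i" "i < n" for i
    proof -
      have "([rh i, rh i], []) \<in> uvb_rels n" using i unfolding uvb_rels_def by simp
      from uvb_class_rel[OF this] show ?thesis using gens[OF i] by (simp add: c2 uvb_class_Nil)
    qed
    show "?c [rh i] \<otimes>\<^bsub>UVB n\<^esub> ?c [rh j] = ?c [rh j] \<otimes>\<^bsub>UVB n\<^esub> ?c [rh i]"
      if "1 \<le> i" "i + 1 < j" "j < n" for i j
      by (rule rel2) (use that in \<open>auto simp: gens uvb_rels_def\<close>)
    show "?c [rh i] \<otimes>\<^bsub>UVB n\<^esub> ?c [rh (i + 1)] \<otimes>\<^bsub>UVB n\<^esub> ?c [rh i] =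
        ?c [rh (i + 1)] \<otimes>\<^bsub>UVB n\<^esub> ?c [rh i] \<otimes>\<^bsub>UVB n\<^esub> ?c [rh (i + 1)]" if "1 \<le> i" "i + 1 < n" for i
      by (rule rel3) (use that in \<open>auto simp: uvb_rels_def\<close>)
    show "uvb_perm n (?c [rh i]) = transpose i (i + 1)" "uvb_perm n (?c [sg i]) = transpose i (i + 1)"
      if "1 \<le> i" "i < n" for i
      using uvb_perm_gen[of i n] that by (simp_all add: uvb_class_def)
    show "commute (UVB n) (?c [sg i]) (?c [sg j])" if "1 \<le> i" "i + 1 < j" "j < n" for i j
      unfolding commute_def by (rule rel2) (use that in \<open>auto simp: gens uvb_rels_def\<close>)
    show "commute (UVB n) (?c [sg i]) (?c [rh j])"
      if "1 \<le> i" "1 \<le> j" "i < n" "j < n" "1 < \<bar>int i - int j\<bar>" for i j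
      unfolding commute_def by (rule rel2) (use that in \<open>auto simp: gens uvb_rels_def\<close>)
    show "?c [sg i] \<otimes>\<^bsub>UVB n\<^esub> ?c [sg (i + 1)] \<otimes>\<^bsub>UVB n\<^esub> ?c [sg i] =
        ?c [sg (i + 1)] \<otimes>\<^bsub>UVB n\<^esub> ?c [sg i] \<otimes>\<^bsub>UVB n\<^esub> ?c [sg (i + 1)]" if "1 \<le> i" "i + 1 < n" for i
      by (rule rel3) (use that in \<open>auto simp: uvb_rels_def\<close>)
    show "?c [sg i] \<otimes>\<^bsub>UVB n\<^esub> ?c [rh (i + 1)] \<otimes>\<^bsub>UVB n\<^esub> ?c [rh i] =
        ?c [rh (i + 1)] \<otimes>\<^bsub>UVB n\<^esub> ?c [rh i] \<otimes>\<^bsub>UVB n\<^esub> ?c [sg (i + 1)]" if "1 \<le> i" "i + 1 < n" for i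
      by (rule rel3) (use that in \<open>auto simp: uvb_rels_def\<close>)
    show "?c [rh i] \<otimes>\<^bsub>UVB n\<^esub> ?c [sg (i + 1)] \<otimes>\<^bsub>UVB n\<^esub> ?c [sg i] =
        ?c [sg (i + 1)] \<otimes>\<^bsub>UVB n\<^esub> ?c [sg i] \<otimes>\<^bsub>UVB n\<^esub> ?c [rh (i + 1)]" if "1 \<le> i" "i + 1 < n" for i
      by (rule rel3) (use that in \<open>auto simp: uvb_rels_def\<close>)
    show "?c [rh (i + 1)] \<otimes>\<^bsub>UVB n\<^esub> ?c [sg i] \<otimes>\<^bsub>UVB n\<^esub> ?c [sg (i + 1)] =
        ?c [sg i] \<otimes>\<^bsub>UVB n\<^esub> ?c [sg (i + 1)] \<otimes>\<^bsub>UVB n\<^esub> ?c [rh i]" if "1 \<le> i" "i + 1 < n" for i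
      by (rule rel3) (use that in \<open>auto simp: uvb_rels_def\<close>)
    show "uvb_action_map n (g \<otimes>\<^bsub>UVB n\<^esub> h) z = uvb_action_map n g (uvb_action_map n h z)"
      if "g \<in> carrier (UVB n)" "h \<in> carrier (UVB n)" for g h z
      by (rule th[OF that])
    show "uvb_action_map n \<one>\<^bsub>UVB n\<^esub> z = z" for z
      using hom_one[OF uvb_action_map_hom group_UVB group_BijGroup] by (simp add: one_BijGroup_UNIV)
    show "uvb_action_map n (?c [rh i]) z = perm_point (transpose i (i + 1)) z"
      "uvb_action_map n (?c [sg i]) z = shear i (i + 1) (perm_point (transpose i (i + 1)) z)"
      if "1 \<le> i" "i < n" for i z
      using gens[OF that] by (simp_all add: uvb_action_map_gen)
  qed (use assms in simp, rule uvb_generated)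
qed

theorem corollary5p2:
  fixes n :: nat
  assumes "n \<ge> 5"
  shows "AutoGroup (UVB n) \<cong>
    (AutoGroup (UVP n))\<lparr>carrier := normalizer (AutoGroup (UVP n)) (UVB_in_Aut n)\<rparr>"
proof -
  interpret uvb_action "UVB n" n "uvb_perm n" "\<lambda>i. uvb_class n [rh i]" "\<lambda>i. uvb_class n [sg i]" "uvb_action_map n"
    by (rule uvb_action_UVB) (use assms in simp)
  have pure: "carrier (UVP n) = pure"
    unfolding pure_def by (simp add: UVP_def kernel_def)
  have UVP: "UVP n = (UVB n)\<lparr>carrier := pure\<rparr>"
    unfolding pure[symmetric] by (simp add: UVP_def)
  define m where "m = order (sym_group n)"
  have "finite (carrier (sym_group n))"
    by (simp add: sym_group_def finite_permutations)
  then have m: "0 < m" unfolding m_def by (simp add: H.order_gt_0_iff_finite)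
  have pow: "g [^]\<^bsub>UVB n\<^esub> m \<in> pure" if "g \<in> carrier (UVB n)" for g
    using that H.pow_order_eq_1[of "uvb_perm n g"] by (intro pureI) (simp_all add: hom_nat_pow m_def)
  show ?thesis
    unfolding UVB_in_Aut_def UVP
  proof (rule G.Aut_iso_normalizer)
    show "pure \<lhd> UVB n" using normal_UVP[of n] by (simp add: pure)
    show "uvb_conj n \<in> hom (UVB n) (AutoGroup (UVB n\<lparr>carrier := pure\<rparr>))"
      using uvb_conj_hom[of n] by (simp add: UVP)
    show "uvb_conj n g p = g \<otimes>\<^bsub>UVB n\<^esub> p \<otimes>\<^bsub>UVB n\<^esub> inv\<^bsub>UVB n\<^esub> g"
      if "g \<in> carrier (UVB n)" "p \<in> pure" for g p
      using that by (simp add: uvb_conj_def pure)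
    show "f ` pure = pure" if "f \<in> auto (UVB n)" for f
      using pure_characteristic[OF m pow that] .
    show "g = \<one>\<^bsub>UVB n\<^esub>" if "g \<in> carrier (UVB n)"
      "\<And>p. p \<in> pure \<Longrightarrow> g \<otimes>\<^bsub>UVB n\<^esub> p = p \<otimes>\<^bsub>UVB n\<^esub> g" for g
      using pure_centralizer that by metis
  qed
qed

end
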